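(* Let $\tilde\pi\in S_N$ be a Grassmannian permutation with descent at $k$ and let $\lambda=\lambda(\tilde\pi)$. Then $\Omega$ is a bijection from the set $SVT_k(\lambda)$ of semistandard set-valued tableaux of shape $\lambda$ with all entries at most $k$ to the set of $k\times N$ pipe dreams $P$ whose elbow tiles form the vertex sets of interior faces of $\Gamma_{\tilde\pi}$, where $\Gamma_{\tilde\pi}=\Delta(Q,\tilde\pi)$ for the word $Q$ of the full $k\times N$ rectangle.
   Context: A permutation is Grassmannian if it has exactly one descent. $D(\pi)=\{(p,q):\pi(p)>q,\ \pi^{-1}(q)>p\}$, and $\lambda(\pi)$ is the partition whose parts are the numbers of boxes in the rows of $D(\pi)$. A $k\times N$ pipe dream is a tiling of the $k\times N$ rectangle by cross tiles and elbow tiles; it is identified with its set of cross positions. A semistandard set-valued tableau $\tau$ of shape $\lambda$ (English notation) assigns to each box a nonempty set of positive integers such that if $b$ is above $c$ (same column) every element of $\tau(b)$ is strictly less than every element of $\tau(c)$, and if $b$ is left of $c$ (same row) every element of $\tau(b)$ is $\le$ every element of $\tau(c)$. $\Omega(\tau)$ is the pipe dream with crosses exactly at the positions $(i,\,i+c-r)$ over all boxes $(r,c)$ of $\lambda$ and all $i\in\tau(r,c)$ (i.e. for each integer $i$ assigned to box $b$, place a cross in row $i$ on the diagonal containing $b$). For a word $Q=(s_{i_1},\dots,s_{i_t})$ of simple reflections $s_i=(i,i+1)$ in $S_m$ and $\rho\in S_m$, the subword complex $\Delta(Q,\rho)$ has as vertices the letters of $Q$ and as faces the sets $Q\setminus P$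 where the subword $P$ has a subsequence whose ordered product is a reduced expression for $\rho$. Here $Q$ is obtained by filling box $(p,q)$ of the $k\times N$ rectangle with $s_{k-p+q}$ and reading each row right to left, from the bottom row to the top row; its letters are identified with the boxes, and $\tilde\pi$ is regarded in a symmetric group $S_m\supseteq S_N$ large enough to contain all letters. Subword complexes are homeomorphic to balls or spheres; boundary faces are those contained in a codimension-one face lying in exactly one facet, and all other faces are interior. *)

theory Defs
  imports Main "HOL-Library.FuncSet" "HOL-Combinatorics.Permutations"
begin

text \<open>An element of \<open>S\<^sub>N\<close> is a function \<open>nat \<Rightarrow> nat\<close> with \<open>\<pi> permutes {1..N}\<close>. It fixes everything
  outside \<open>{1..N}\<close>, so the same function also represents its image in any larger \<open>S\<^sub>m\<close>.\<close>

definition descents :: "nat \<Rightarrow> (nat \<Rightarrow> nat) \<Rightarrow> nat set" where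
  "descents N \<pi> = {i. 1 \<le> i \<and> i < N \<and> \<pi> i > \<pi> (i + 1)}"

definition grassmannian :: "nat \<Rightarrow> (nat \<Rightarrow> nat) \<Rightarrow> bool" where
  "grassmannian N \<pi> \<longleftrightarrow> \<pi> permutes {1..N} \<and> card (descents N \<pi>) = 1"

definition diagram :: "nat \<Rightarrow> (nat \<Rightarrow> nat) \<Rightarrow> (nat \<times> nat) set" where
  "diagram N \<pi> = {(p, q). p \<in> {1..N} \<and> q \<in> {1..N} \<and> \<pi> p > q \<and> inv \<pi> q > p}"

text \<open>A partition is the weakly decreasing list of its positive parts.\<close>

definition perm_partition :: "nat \<Rightarrow> (nat \<Rightarrow> nat) \<Rightarrow> nat list" where
  "perm_partition N \<pi> =
     rev (sort (filter (\<lambda>x. x > 0) (map (\<lambda>p. card {q. (p, q) \<in> diagram N \<pi>}) [1..<N + 1])))"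

text \<open>Boxes are pairs (row, column), both counted from 1, with rows numbered downwards.\<close>

definition shape :: "nat list \<Rightarrow> (nat \<times> nat) set" where
  "shape lam = {(r, c). 1 \<le> r \<and> r \<le> length lam \<and> 1 \<le> c \<and> c \<le> lam ! (r - 1)}"

text \<open>The extensional function space makes a tableau determined by its values on the boxes of
  its shape.\<close>

definition set_valued_tableau :: "nat list \<Rightarrow> (nat \<times> nat \<Rightarrow> nat set) \<Rightarrow> bool" where
  "set_valued_tableau lam \<tau> \<longleftrightarrow>
     \<tau> \<in> shape lam \<rightarrow>\<^sub>E {A. A \<noteq> {} \<and> (\<forall>x\<in>A. x > 0)} \<and>
     (\<forall>r r' c. (r, c) \<in> shape lam \<longrightarrow> (r', c) \<in> shape lam \<longrightarrow> r < r' \<longrightarrow>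
        (\<forall>x\<in>\<tau> (r, c). \<forall>y\<in>\<tau> (r', c). x < y)) \<and>
     (\<forall>r c c'. (r, c) \<in> shape lam \<longrightarrow> (r, c') \<in> shape lam \<longrightarrow> c < c' \<longrightarrow>
        (\<forall>x\<in>\<tau> (r, c). \<forall>y\<in>\<tau> (r, c'). x \<le> y))"

definition SVT :: "nat \<Rightarrow> nat list \<Rightarrow> (nat \<times> nat \<Rightarrow> nat set) set" where
  "SVT k lam = {\<tau>. set_valued_tableau lam \<tau> \<and> (\<forall>b\<in>shape lam. \<forall>x\<in>\<tau> b. x \<le> k)}"

definition rect :: "nat \<Rightarrow> nat \<Rightarrow> (nat \<times> nat) set" where
  "rect k N = {1..k} \<times> {1..N}"

text \<open>A pipe dream is identified with its set of crosses; the elbows are the rest of the rectangle.\<close>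

definition pipe_dreams :: "nat \<Rightarrow> nat \<Rightarrow> (nat \<times> nat) set set" where
  "pipe_dreams k N = Pow (rect k N)"

text \<open>In a semistandard tableau every entry \<open>i\<close> in row \<open>r\<close> satisfies \<open>i \<ge> r\<close>, because columns
  strictly increase, so the subtraction on \<open>nat\<close> below is never truncated.\<close>

definition Omega :: "nat list \<Rightarrow> (nat \<times> nat \<Rightarrow> nat set) \<Rightarrow> (nat \<times> nat) set" where
  "Omega lam \<tau> = {(i, i + c - r) | i r c. (r, c) \<in> shape lam \<and> i \<in> \<tau> (r, c)}"

text \<open>A word in the simple reflections \<open>s\<^sub>i = (i, i+1)\<close> is the list of its indices, and
  \<open>[i\<^sub>1, \<dots>, i\<^sub>t]\<close> has product \<open>s\<^bsub>i\<^sub>1\<^esub> \<circ> \<dots> \<circ> s\<^bsub>i\<^sub>t\<^esub>\<close>, composed as functions (rightmost letter acts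
  first). With this convention a permutation having a descent at \<open>k\<close> has a reduced
  expression ending in \<open>s\<^sub>k\<close>.\<close>

definition word_prod :: "nat list \<Rightarrow> nat \<Rightarrow> nat" where
  "word_prod w = foldr (\<lambda>i f. transpose i (i + 1) \<circ> f) w id"

definition reduced_expression :: "nat \<Rightarrow> (nat \<Rightarrow> nat) \<Rightarrow> nat list \<Rightarrow> bool" where
  "reduced_expression m \<rho> w \<longleftrightarrow>
     set w \<subseteq> {1..<m} \<and> word_prod w = \<rho> \<and>
     (\<forall>v. set v \<subseteq> {1..<m} \<and> word_prod v = \<rho> \<longrightarrow> length w \<le> length v)"

text \<open>The letters of \<open>Q\<close> are represented by their positions, so that equal letters at different
  positions are different vertices.\<close>

definition subword_complex :: "nat \<Rightarrow> nat list \<Rightarrow> (nat \<Rightarrow> nat) \<Rightarrow> nat set set" where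
  "subword_complex m Q \<rho> =
     {{..<length Q} - P | P. P \<subseteq> {..<length Q} \<and>
        (\<exists>R\<subseteq>P. reduced_expression m \<rho> (nths Q R))}"

definition reading_order :: "nat \<Rightarrow> nat \<Rightarrow> (nat \<times> nat) list" where
  "reading_order k N = concat (map (\<lambda>p. map (\<lambda>q. (p, q)) (rev [1..<N + 1])) (rev [1..<k + 1]))"

definition rect_word :: "nat \<Rightarrow> nat \<Rightarrow> nat list" where
  "rect_word k N = map (\<lambda>(p, q). k - p + q) (reading_order k N)"

text \<open>The subword complex of the rectangle word in \<open>S\<^sub>m\<close>, with the letter at position \<open>j\<close>
  identified with the \<open>j\<close>-th box in reading order.\<close>

definition Gamma :: "nat \<Rightarrow> nat \<Rightarrow> nat \<Rightarrow> (nat \<Rightarrow> nat) \<Rightarrow> (nat \<times> nat) set set" where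
  "Gamma m k N \<pi> =
     (\<lambda>F. (\<lambda>j. reading_order k N ! j) ` F) ` subword_complex m (rect_word k N) \<pi>"

text \<open>A finite simplicial complex is given by its set of faces, including the empty face.\<close>

definition facets :: "'a set set \<Rightarrow> 'a set set" where
  "facets \<Delta> = {F \<in> \<Delta>. \<forall>G\<in>\<Delta>. F \<subseteq> G \<longrightarrow> G = F}"

text \<open>A face \<open>F\<close> has dimension \<open>card F - 1\<close>; the dimension of the complex is the largest dimension of
  a face.\<close>

definition codim_one_faces :: "'a set set \<Rightarrow> 'a set set" where
  "codim_one_faces \<Delta> = {F \<in> \<Delta>. card F + 1 = Max (card ` \<Delta>)}"

definition boundary_faces :: "'a set set \<Rightarrow> 'a set set" where
  "boundary_faces \<Delta> =
     {F \<in> \<Delta>. \<exists>G\<in>codim_one_faces \<Delta>. F \<subseteq> G \<and> (\<exists>!H. H \<in> facets \<Delta> \<and> G \<subseteq> H)}"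

definition interior_faces :: "'a set set \<Rightarrow> 'a set set" where
  "interior_faces \<Delta> = \<Delta> - boundary_faces \<Delta>"

end

theory Submission
  imports Defs "HOL-Library.Product_Lexorder"
begin

text \<open>Read the crosses in lexicographic order of their positions, i.e. the word from right to left.
  A word for \<open>\<pi>\<close> is reduced iff every letter \<open>s\<^sub>j\<close> moves the value \<open>j\<close> out of the set
  \<open>\<rho> ` {1..k}\<close> of first \<open>k\<close> values to the free value \<open>j + 1\<close>, because each letter raises the sum of
  these values by at most one. Each such move adds a box to a Young diagram, so
  the reduced subwords are exactly the fillings of \<open>\<lambda>\<close> by crosses on the diagonals of the boxes that
  increase lexicographically along rows and columns: the single-valued tableaux.

  A face with cross set \<open>P\<close> is interior iff \<open>P\<close> contains a reduced subword \<open>R\<close> and, for all such \<open>R\<close>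
  and all \<open>y \<in> P - R\<close>, there is a second reduced subword inside \<open>R \<union> {y}\<close>. This exchange property
  characterizes the cross sets of set-valued tableaux. If \<open>P\<close> comes from \<open>T\<close>, then any reduced
  \<open>R \<subseteq> P\<close> selects an element of each \<open>T b\<close>, and the selected element of the box containing \<open>y\<close> can
  be replaced by \<open>y\<close>. Conversely, the sets of all values at \<open>b\<close> of single-valued tableaux inside
  \<open>P\<close> form a set-valued tableau.\<close>

section \<open>Reduced words and the sum of the first values\<close>

text \<open>At a first point of disagreement, the value of either function is attained by the other
  one there or later, hence is at least the value of the other one there.\<close>

lemma strict_mono_on_image_eq_imp_eq:
  fixes f g :: "'a::wellorder \<Rightarrow> 'b::linorder"
  assumes f: "strict_mono_on A f" and g: "strict_mono_on A g" and im: "f ` A = g ` A"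
    and "x \<in> A"
  shows "f x = g x"
  using \<open>x \<in> A\<close>
proof (induction x rule: less_induct)
  case (less x)
  have le: "v x \<le> u x"
    if u: "strict_mono_on A u" and v: "strict_mono_on A v" and "u ` A = v ` A"
      and IH: "\<And>y. y < x \<Longrightarrow> y \<in> A \<Longrightarrow> u y = v y" for u v :: "'a \<Rightarrow> 'b"
  proof -
    from less.prems that(3) obtain e where e: "e \<in> A" "u x = v e" by (metis imageE imageI)
    have "\<not> e < x"
      using IH[of e] e u less.prems by (metis less_irrefl strict_mono_onD)
    then show ?thesis
      using v e less.prems by (metis linorder_not_less order.order_iff_strict strict_mono_onD)
  qed
  show ?case
    using le[of f g] le[of g f] f g im less.IH by force
qed

lemma strict_mono_on_add_le:
  fixes f :: "nat \<Rightarrow> nat"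
  assumes f: "strict_mono_on {a..b} f" and "a \<le> i" "i \<le> j" "j \<le> b"
  shows "f i + (j - i) \<le> f j"
  using \<open>i \<le> j\<close> \<open>j \<le> b\<close>
proof (induction j rule: dec_induct)
  case (step n)
  have "f n < f (Suc n)" using f \<open>a \<le> i\<close> step by (intro strict_mono_onD[OF f]) auto
  then show ?case using step by simp
qed simp

section \<open>Products of words and a lower bound for their length\<close>

lemma word_prod_Nil [simp]: "word_prod [] = id"
  by (simp add: word_prod_def)

lemma word_prod_Cons [simp]: "word_prod (j # w) = transpose j (j + 1) \<circ> word_prod w"
  by (simp add: word_prod_def)

lemma bij_word_prod: "bij (word_prod w)"
proof (induction w)
  case (Cons j w)
  then show ?case unfolding word_prod_Cons by (intro bij_comp[OF _ bij_transpose])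
qed (simp add: bij_id[unfolded id_def])

lemma inj_on_word_prod: "inj_on (word_prod w) A"
  using bij_word_prod[of w] by (meson bij_def inj_on_subset subset_UNIV)

text \<open>Only the membership of \<open>j\<close> and \<open>j + 1\<close> matters: the swap
  changes the sum by one if exactly one of them is in \<open>S\<close>, upwards if it is
  \<open>j\<close>, and leaves it alone otherwise.\<close>

lemma sum_transpose_Suc:
  fixes S :: "nat set"
  assumes "finite S"
  shows "(\<Sum>v\<in>S. transpose j (j + 1) v) \<le> \<Sum>S + 1"
    and "(\<Sum>v\<in>S. transpose j (j + 1) v) = \<Sum>S + 1 \<longleftrightarrow> j \<in> S \<and> j + 1 \<notin> S"
proof -
  let ?s = "transpose j (j + 1)"
  define U where "U = S - {j, j + 1}"
  have U: "finite U" "j \<notin> U" "j + 1 \<notin> U" using assms by (auto simp: U_def)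
  have sU: "sum ?s U = \<Sum>U"
    by (rule sum.cong) (auto simp: U_def transpose_def)
  consider "j \<in> S" "j + 1 \<in> S" "S = insert j (insert (j + 1) U)"
    | "j \<in> S" "j + 1 \<notin> S" "S = insert j U" | "j \<notin> S" "j + 1 \<in> S" "S = insert (j + 1) U"
    | "j \<notin> S" "j + 1 \<notin> S" "S = U"
    unfolding U_def by blast
  then have "sum ?s S \<le> \<Sum>S + 1 \<and> (sum ?s S = \<Sum>S + 1 \<longleftrightarrow> j \<in> S \<and> j + 1 \<notin> S)"
    by cases (use U sU in \<open>simp_all del: Suc_eq_plus1 add: transpose_apply_first transpose_apply_second\<close>)
  then show "sum ?s S \<le> \<Sum>S + 1" "sum ?s S = \<Sum>S + 1 \<longleftrightarrow> j \<in> S \<and> j + 1 \<notin> S" by auto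
qed

text \<open>Words grow at the front because the rightmost letter acts first, so
  \<open>word_prod w\<close> is the permutation on which the letter \<open>j\<close> acts.\<close>

primrec upwalk :: "nat \<Rightarrow> nat list \<Rightarrow> bool" where
  "upwalk k [] \<longleftrightarrow> True"
| "upwalk k (j # w) \<longleftrightarrow>
     upwalk k w \<and> j \<in> word_prod w ` {1..k} \<and> j + 1 \<notin> word_prod w ` {1..k}"

text \<open>The sum of the first \<open>k\<close> values is a potential: it bounds word lengths from
  below and detects shortest words without counting inversions.\<close>

lemma sum_word_prod:
  "(\<Sum>i=1..k. word_prod w i) \<le> \<Sum>{1..k} + length w \<and>
   ((\<Sum>i=1..k. word_prod w i) = \<Sum>{1..k} + length w \<longleftrightarrow> upwalk k w)"
proof (induction w)
  case (Cons j w)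
  let ?S = "word_prod w ` {1..k}"
  have 1: "(\<Sum>i=1..k. word_prod w i) = \<Sum>?S"
    using sum.reindex[OF inj_on_word_prod, of "\<lambda>x. x"] by simp
  have 2: "(\<Sum>i=1..k. word_prod (j # w) i) = (\<Sum>v\<in>?S. transpose j (j + 1) v)"
    using sum.reindex[OF inj_on_word_prod, of "transpose j (j + 1)"] by simp
  show ?case
    using Cons.IH sum_transpose_Suc[of ?S j] unfolding 1 2 by auto
qed simp

lemma upwalk_step:
  assumes "upwalk k (j # w)"
  obtains i where "i \<in> {1..k}" "word_prod w i = j" "word_prod (j # w) i = j + 1"
    "\<And>i'. i' \<in> {1..k} \<Longrightarrow> i' \<noteq> i \<Longrightarrow> word_prod (j # w) i' = word_prod w i'"
proof -
  from assms obtain i where i: "i \<in> {1..k}" "word_prod w i = j" by auto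
  show thesis
  proof (rule that[OF i])
    show "word_prod (j # w) i = j + 1" using i by simp
    fix i' assume i': "i' \<in> {1..k}" "i' \<noteq> i"
    have "word_prod w i' \<noteq> j" using i i' bij_word_prod[of w] by (metis bij_pointE)
    moreover have "word_prod w i' \<noteq> j + 1" using assms i'(1) by (metis image_eqI upwalk.simps(2))
    ultimately show "word_prod (j # w) i' = word_prod w i'" by (simp add: transpose_def)
  qed
qed

text \<open>The swap of \<open>j\<close> and \<open>j + 1\<close> reverses the order of no other
  pair of values. The value \<open>j\<close> is taken on \<open>{1..k}\<close> and
  \<open>j + 1\<close> is not, so within either block at most one of the two occurs.\<close>

lemma strict_mono_on_word_prod:
  assumes "upwalk k w"
  shows "strict_mono_on {1..k} (word_prod w)" "strict_mono_on {k<..} (word_prod w)"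
proof -
  have "strict_mono_on {1..k} (word_prod w) \<and> strict_mono_on {k<..} (word_prod w)"
    using assms
  proof (induction w)
    case Nil
    show ?case by (auto intro!: strict_mono_onI)
  next
    case (Cons j w)
    let ?f = "word_prod w"
    have IH: "strict_mono_on {1..k} ?f" "strict_mono_on {k<..} ?f" using Cons by auto
    have j: "j \<in> ?f ` {1..k}" "j + 1 \<notin> ?f ` {1..k}" using Cons.prems by auto
    have inj: "?f a = ?f b \<longleftrightarrow> a = b" for a b
      using bij_word_prod[of w] by (metis bij_pointE)
    have nj: "?f a \<noteq> j" if "a > k" for a
      using j(1) that by (auto simp: inj)
    have nj1: "?f a \<noteq> j + 1" if "a \<in> {1..k}" for a
      using j(2) that by (metis image_eqI)
    have 1: "transpose j (j + 1) x < transpose j (j + 1) y" if "x < y" "x \<noteq> j + 1" "y \<noteq> j + 1" for x y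
      using that by (auto simp: transpose_def)
    have 2: "transpose j (j + 1) x < transpose j (j + 1) y" if "x < y" "x \<noteq> j" "y \<noteq> j" for x y
      using that by (auto simp: transpose_def)
    show ?case
    proof (intro conjI strict_mono_onI)
      fix a b assume "a \<in> {1..k}" "b \<in> {1..k}" "a < b"
      then show "word_prod (j # w) a < word_prod (j # w) b"
        using 1 nj1 strict_mono_onD[OF IH(1)] by simp
    next
      fix a b assume "a \<in> {k<..}" "b \<in> {k<..}" "a < b"
      then show "word_prod (j # w) a < word_prod (j # w) b"
        using 2 nj strict_mono_onD[OF IH(2)] by simp
    qed
  qed
  then show "strict_mono_on {1..k} (word_prod w)" "strict_mono_on {k<..} (word_prod w)" by auto
qed

lemma word_prod_0: "0 \<notin> set w \<Longrightarrow> word_prod w 0 = 0"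
  by (induction w) (auto simp: transpose_def)

lemma word_prod_ge:
  assumes "upwalk k w" and "0 \<notin> set w" and "i \<in> {1..k}"
  shows "i \<le> word_prod w i"
proof -
  have "word_prod w 1 \<noteq> 0"
    using bij_word_prod[of w] word_prod_0[OF assms(2)] by (metis bij_pointE zero_neq_one)
  then show ?thesis
    using strict_mono_on_add_le[OF strict_mono_on_word_prod(1)[OF assms(1)], of 1 i] assms(3) by auto
qed

text \<open>The image of \<open>{1..k}\<close> determines that of \<open>{k<..}\<close> by
  complement, and an increasing function is determined by its image.\<close>

lemma permutation_eqI_images:
  fixes \<pi> :: "nat \<Rightarrow> nat"
  assumes "bij \<pi>" "bij \<rho>" and "\<pi> 0 = 0" "\<rho> 0 = 0"
    and "strict_mono_on {1..k} \<pi>" "strict_mono_on {1..k} \<rho>"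
    and "strict_mono_on {k<..} \<pi>" "strict_mono_on {k<..} \<rho>"
    and im: "\<pi> ` {1..k} = \<rho> ` {1..k}"
  shows "\<pi> = \<rho>"
proof
  fix i
  have compl: "{k<..} = - insert 0 {1..k}" by auto
  have "\<pi> ` {k<..} = \<rho> ` {k<..}"
    unfolding compl using assms by (simp add: bij_image_Compl_eq)
  then show "\<pi> i = \<rho> i"
    using strict_mono_on_image_eq_imp_eq[OF assms(5,6) im, of i]
      strict_mono_on_image_eq_imp_eq[OF assms(7,8), of i] assms(3,4)
    by (cases "i = 0"; cases "i \<le> k") auto
qed

section \<open>Tableaux and Young diagrams\<close>

definition letter :: "nat \<Rightarrow> nat \<times> nat \<Rightarrow> nat" where
  "letter k = (\<lambda>(p, q). k - p + q)"

text \<open>Boxes carry positions of crosses on their own diagonal, in lexicographic order. On fixed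
  diagonals this single strict order means weakly increasing row numbers along rows of
  \<open>D\<close> and strictly increasing ones down columns.\<close>

definition set_tab :: "(nat \<times> nat) set \<Rightarrow> (nat \<times> nat \<Rightarrow> (nat \<times> nat) set) \<Rightarrow> bool" where
  "set_tab D T \<longleftrightarrow>
     (\<forall>b\<in>D. T b \<noteq> {} \<and> (\<forall>x\<in>T b. fst x + snd b = snd x + fst b)) \<and>
     (\<forall>b\<in>D. \<forall>b'\<in>D. fst b \<le> fst b' \<longrightarrow> snd b \<le> snd b' \<longrightarrow> b \<noteq> b' \<longrightarrow>
        (\<forall>x\<in>T b. \<forall>y\<in>T b'. x < y))"

definition tab :: "(nat \<times> nat) set \<Rightarrow> (nat \<times> nat \<Rightarrow> nat \<times> nat) \<Rightarrow> bool" where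
  "tab D t \<longleftrightarrow> set_tab D (\<lambda>b. {t b})"

text \<open>Row \<open>r\<close> belongs to the argument \<open>i = k + 1 - r\<close> and has
  \<open>\<rho> i - i\<close> boxes; for increasing \<open>\<rho>\<close> the reversal puts the
  longest row on top.\<close>

definition young :: "nat \<Rightarrow> (nat \<Rightarrow> nat) \<Rightarrow> (nat \<times> nat) set" where
  "young k \<rho> = {(r, c). 1 \<le> r \<and> r \<le> k \<and> 1 \<le> c \<and> c + (k + 1 - r) \<le> \<rho> (k + 1 - r)}"

definition down_closed :: "(nat \<times> nat) set \<Rightarrow> bool" where
  "down_closed D \<longleftrightarrow> (\<forall>r c r' c'. (r, c) \<in> D \<longrightarrow> 1 \<le> r' \<longrightarrow> r' \<le> r \<longrightarrow> 1 \<le> c' \<longrightarrow> c' \<le> c \<longrightarrow> (r', c') \<in> D)"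

lemma down_closedD:
  "down_closed D \<Longrightarrow> (r, c) \<in> D \<Longrightarrow> 1 \<le> r' \<Longrightarrow> r' \<le> r \<Longrightarrow> 1 \<le> c' \<Longrightarrow> c' \<le> c \<Longrightarrow> (r', c') \<in> D"
  unfolding down_closed_def by blast

lemma down_closed_young:
  assumes "strict_mono_on {1..k} \<rho>"
  shows "down_closed (young k \<rho>)"
  unfolding down_closed_def
proof (intro allI impI)
  fix r c r' c' assume h: "(r, c) \<in> young k \<rho>" "1 \<le> r'" "r' \<le> r" "1 \<le> c'" "c' \<le> c"
  then have "\<rho> (k + 1 - r) + ((k + 1 - r') - (k + 1 - r)) \<le> \<rho> (k + 1 - r')"
    by (intro strict_mono_on_add_le[OF assms]) (auto simp: young_def)
  then show "(r', c') \<in> young k \<rho>" using h by (auto simp: young_def)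
qed

lemma tabD:
  assumes "tab D t" "b \<in> D"
  shows "fst (t b) + snd b = snd (t b) + fst b"
    and "b' \<in> D \<Longrightarrow> fst b \<le> fst b' \<Longrightarrow> snd b \<le> snd b' \<Longrightarrow> b \<noteq> b' \<Longrightarrow> t b < t b'"
  using assms unfolding tab_def set_tab_def by auto

lemma tab_diag:
  assumes "tab D t" "b \<in> D" "b' \<in> D" "t b = t b'"
  shows "fst b + snd b' = snd b + fst b'"
  using tabD(1)[OF assms(1,2)] tabD(1)[OF assms(1,3)] assms(4) by simp

text \<open>Boxes with equal entries share a diagonal, so one lies weakly below and right of the
  other, and distinct boxes comparable in this way have different entries.\<close>

lemma inj_on_tab:
  assumes "tab D t"
  shows "inj_on t D"
proof (rule inj_onI, rule ccontr)
  fix b b' assume b: "b \<in> D" "b' \<in> D" "t b = t b'" "b \<noteq> b'"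
  then have "(fst b \<le> fst b' \<and> snd b \<le> snd b') \<or> (fst b' \<le> fst b \<and> snd b' \<le> snd b)"
    using tab_diag[OF assms b(1-3)] by linarith
  then show False
    using tabD(2)[OF assms, of b b'] tabD(2)[OF assms, of b' b] b by auto
qed

text \<open>Processing a cross on the diagonal of box \<open>b = (r, c)\<close> moves the value at \<open>k + 1 - r\<close> up by
  one, that is, it adds \<open>b\<close> to the Young diagram.\<close>

lemma young_step:
  assumes "upwalk k (j # w)" "0 \<notin> set w" "r \<in> {1..k}" "word_prod w (k + 1 - r) = j" "j + r = k + c"
  shows "young k (word_prod (j # w)) = insert (r, c) (young k (word_prod w))"
    and "(r, c) \<notin> young k (word_prod w)" and "1 \<le> c"
proof -
  obtain i where i: "i \<in> {1..k}" "word_prod w i = j" "word_prod (j # w) i = j + 1"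
    "\<And>i'. i' \<in> {1..k} \<Longrightarrow> i' \<noteq> i \<Longrightarrow> word_prod (j # w) i' = word_prod w i'"
    using upwalk_step[OF assms(1)] by blast
  have ir: "i = k + 1 - r"
    using i(2) assms(4) bij_word_prod[of w] by (metis bij_pointE)
  have "i \<le> j" using word_prod_ge[of k w i] assms(1,2) i by simp
  then show c1: "1 \<le> c" using assms ir by auto
  show "(r, c) \<notin> young k (word_prod w)" using assms by (auto simp: young_def)
  have "(r', c') \<in> young k (word_prod (j # w)) \<longleftrightarrow> (r', c') = (r, c) \<or> (r', c') \<in> young k (word_prod w)"
    for r' c'
  proof (cases "r' \<in> {1..k}")
    case True
    show ?thesis
    proof (cases "r' = r")
      case True
      have "word_prod (j # w) (k + 1 - r) = j + 1" "word_prod w (k + 1 - r) = j"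
        using i ir by auto
      then show ?thesis using True assms(3,5) c1 unfolding young_def by auto
    next
      case False
      then have "word_prod (j # w) (k + 1 - r') = word_prod w (k + 1 - r')"
        using True assms(3) ir by (intro i(4)) auto
      then show ?thesis using False by (simp add: young_def)
    qed
  next
    case False
    then show ?thesis using assms(3) by (auto simp: young_def)
  qed
  then show "young k (word_prod (j # w)) = insert (r, c) (young k (word_prod w))" by auto
qed

text \<open>Each cross labels the box added by its letter. The tail of the decreasing list acts
  first, so a new entry exceeds all earlier ones, and by down-closure no earlier box lies weakly
  below and right of the new one.\<close>

lemma tab_of_upwalk:
  assumes "sorted_wrt (>) xs" "set xs \<subseteq> {(p, q). p \<le> k \<and> 1 \<le> q}" "upwalk k (map (letter k) xs)"
  shows "\<exists>t. tab (young k (word_prod (map (letter k) xs))) t \<and>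
           t ` young k (word_prod (map (letter k) xs)) = set xs"
  using assms
proof (induction xs)
  case Nil
  have "young k (word_prod (map (letter k) [])) = {}" by (auto simp: young_def)
  then show ?case by (simp only:) (simp add: tab_def set_tab_def)
next
  case (Cons x xs)
  let ?w = "map (letter k) xs" and ?j = "letter k x"
  let ?D = "young k (word_prod ?w)"
  from Cons obtain t where t: "tab ?D t" "t ` ?D = set xs" by auto
  obtain p q where x: "x = (p, q)" by force
  have pq: "p \<le> k" "1 \<le> q" using Cons.prems x by auto
  have up: "upwalk k (?j # ?w)" using Cons.prems(3) by simp
  have n0: "0 \<notin> set ?w" using Cons.prems(2) by (auto simp: letter_def)
  obtain i where i: "i \<in> {1..k}" "word_prod ?w i = ?j"
    using upwalk_step[OF up] by blast
  have "i \<le> ?j" using word_prod_ge[of k ?w i] up n0 i by simp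
  \<comment> \<open>The value at \<open>i\<close> rises to \<open>?j + 1\<close>, so the row of
    \<open>i\<close> grows to \<open>?j + 1 - i\<close> boxes; the last of them is the new
    box.\<close>
  define r c where "r = k + 1 - i" and "c = ?j + 1 - i"
  have rc: "r \<in> {1..k}" "word_prod ?w (k + 1 - r) = ?j" "?j + r = k + c"
    using i \<open>i \<le> ?j\<close> by (auto simp: r_def c_def)
  note st = young_step[OF up n0 rc]
  let ?D' = "insert (r, c) ?D"
  have dc: "down_closed ?D"
    using up by (intro down_closed_young strict_mono_on_word_prod) simp
  have gt: "t b < x" if "b \<in> ?D" for b
    using that t(2) Cons.prems(1) by auto
  have "p + c = q + r" using rc(3) pq by (auto simp: letter_def x)
  have no: False if "b \<in> ?D" "r \<le> fst b" "c \<le> snd b" for b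
    using st(2,3) down_closedD[OF dc, of "fst b" "snd b" r c] that rc(1) by auto
  have "tab ?D' (t((r, c) := x))"
    unfolding tab_def set_tab_def
    using gt no tabD[OF t(1)] st(2) \<open>p + c = q + r\<close> x by auto
  moreover have "(t((r, c) := x)) ` ?D' = set (x # xs)"
    using st(2) t(2) by auto
  ultimately show ?case
    using st(1) by (metis list.simps(9))
qed

text \<open>The largest cross occupies a corner of \<open>D\<close>. Removing it leaves a smaller
  tableau, to which induction applies; it remains to see that the letter of the removed cross is a
  legal upward move.\<close>

lemma upwalk_of_tab:
  assumes "sorted_wrt (>) xs" "set xs \<subseteq> {(p, q). p \<le> k \<and> 1 \<le> q}"
    and "down_closed D" "D \<subseteq> {1..k} \<times> {1..}" "tab D t" "t ` D = set xs"
  shows "upwalk k (map (letter k) xs) \<and> young k (word_prod (map (letter k) xs)) = D"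
  using assms
proof (induction xs arbitrary: D)
  case Nil
  then show ?case by (auto simp: young_def)
next
  case (Cons x xs)
  let ?w = "map (letter k) xs" and ?j = "letter k x"
  obtain p q where x: "x = (p, q)" by force
  obtain r c where b: "(r, c) \<in> D" "t (r, c) = x"
    using Cons.prems(6) by (metis imageE list.set_intros(1) surj_pair)
  let ?D = "D - {(r, c)}"
  have rk: "r \<in> {1..k}" "1 \<le> c" using b Cons.prems(4) by auto
  have kr: "k + 1 - r \<in> {1..k}" using rk by (simp, arith)
  have le: "t b' \<le> x" if "b' \<in> D" for b'
    using that Cons.prems(1,6) by fastforce
  have max: False if "b' \<in> D" "b' \<noteq> (r, c)" "r \<le> fst b'" "c \<le> snd b'" for b'
    using tabD(2)[OF Cons.prems(5) b(1), of b'] that le[of b'] b(2) by auto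
  have inj: "inj_on t D" using Cons.prems(5) by (rule inj_on_tab)
  have dc: "down_closed ?D"
    unfolding down_closed_def
  proof (intro allI impI)
    fix r1 c1 r' c' assume h: "(r1, c1) \<in> ?D" "1 \<le> r'" "r' \<le> r1" "1 \<le> c'" "c' \<le> c1"
    then have "(r', c') \<in> D" using down_closedD[OF Cons.prems(3)] by blast
    then show "(r', c') \<in> ?D" using max[of "(r1, c1)"] h by auto
  qed
  have im: "t ` ?D = set xs"
  proof -
    have "x \<notin> set xs" using Cons.prems(1) by auto
    moreover have "x \<notin> t ` ?D" using inj_on_image_mem_iff[OF inj] b by blast
    moreover have "insert x (t ` ?D) = t ` D" using b by blast
    ultimately show ?thesis using Cons.prems(6) by (metis insert_ident list.simps(15))
  qed
  have "tab ?D t" using Cons.prems(5) unfolding tab_def set_tab_def by blast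
  then have IH: "upwalk k ?w" "young k (word_prod ?w) = ?D"
    using Cons.IH[of ?D] Cons.prems dc im by auto
  let ?\<rho> = "word_prod ?w"
  have n0: "0 \<notin> set ?w" using Cons.prems(2) by (auto simp: letter_def)
  have "p + c = q + r" using tabD(1)[OF Cons.prems(5) b(1)] b(2) x by simp
  moreover have "p \<le> k" using Cons.prems(2) x by auto
  ultimately have j: "?j + r = k + c" by (auto simp: letter_def x)
  \<comment> \<open>Row \<open>r\<close> of \<open>?D\<close> has exactly \<open>c - 1\<close>
    boxes, bounded above here and below in \<open>lo\<close>; this fixes the value at
    \<open>k + 1 - r\<close>.\<close>
  have "(r, c) \<notin> young k ?\<rho>" using IH by simp
  then have up: "?\<rho> (k + 1 - r) < c + (k + 1 - r)" using rk by (auto simp: young_def)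
  have lo: "c + (k + 1 - r) \<le> ?\<rho> (k + 1 - r) + 1"
  proof (cases "c = 1")
    case True
    then show ?thesis using word_prod_ge[OF IH(1) n0 kr] by simp
  next
    case False
    then have "(r, c - 1) \<in> ?D" using down_closedD[OF Cons.prems(3) b(1), of r "c - 1"] rk by auto
    then have "(r, c - 1) \<in> young k ?\<rho>" using IH(2) by simp
    then show ?thesis using rk unfolding young_def by auto
  qed
  have val: "?\<rho> (k + 1 - r) = ?j" using up lo j rk by auto
  \<comment> \<open>Arguments up to \<open>k + 1 - r\<close> have values at most \<open>?j\<close>.
    The next argument belongs to row \<open>r - 1\<close>, which has at least \<open>c\<close>
    boxes, so values from there on are at least \<open>?j + 2\<close>.\<close>
  have nj: "?j + 1 \<noteq> ?\<rho> i" if i: "i \<in> {1..k}" for i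
  proof (cases "i \<le> k + 1 - r")
    case True
    then have "?\<rho> i \<le> ?\<rho> (k + 1 - r)"
      using strict_mono_on_add_le[OF strict_mono_on_word_prod(1)[OF IH(1)], of i "k + 1 - r"] i kr
      by fastforce
    then show ?thesis using val by simp
  next
    case False
    then have "r \<ge> 2" using i by auto
    then have "(r - 1, c) \<in> ?D"
      using down_closedD[OF Cons.prems(3) b(1), of "r - 1" c] rk by auto
    then have "(r - 1, c) \<in> young k ?\<rho>" using IH(2) by simp
    then have "c + (k + 1 - (r - 1)) \<le> ?\<rho> (k + 1 - (r - 1))"
      by (auto simp only: young_def mem_Collect_eq prod.case)
    moreover have "1 \<le> k + 1 - (r - 1)" "k + 1 - (r - 1) \<le> i" using i rk False by auto
    then have "?\<rho> (k + 1 - (r - 1)) \<le> ?\<rho> i"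
      using strict_mono_on_add_le[OF strict_mono_on_word_prod(1)[OF IH(1)], of "k + 1 - (r - 1)" i] i
      by fastforce
    ultimately show ?thesis using j rk \<open>r \<ge> 2\<close> by auto
  qed
  have "?j \<in> ?\<rho> ` {1..k}" using val kr by (metis image_eqI)
  moreover have "?j + 1 \<notin> ?\<rho> ` {1..k}" using nj by blast
  ultimately have upw: "upwalk k (?j # ?w)" using IH(1) by simp
  have "young k (word_prod (?j # ?w)) = D"
    unfolding young_step(1)[OF upw n0 rk(1) val j] IH(2) using b(1) by (rule insert_Diff)
  then show ?case unfolding list.map using upw by blast
qed

section \<open>The exchange property of set-valued tableaux\<close>

lemma set_tabD:
  assumes "set_tab D T" "b \<in> D"
  shows "T b \<noteq> {}"
    and "x \<in> T b \<Longrightarrow> fst x + snd b = snd x + fst b"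
    and "b' \<in> D \<Longrightarrow> fst b \<le> fst b' \<Longrightarrow> snd b \<le> snd b' \<Longrightarrow> b \<noteq> b' \<Longrightarrow> x \<in> T b \<Longrightarrow> y \<in> T b' \<Longrightarrow> x < y"
  using assms unfolding set_tab_def by auto

text \<open>Neighbours suffice: from \<open>b'\<close> one walks back to \<open>b\<close> through
  left and upper neighbours. Down-closure keeps the walk inside \<open>D\<close>, and nonemptiness
  supplies an intermediate element at each box.\<close>

lemma set_tabI:
  assumes dc: "down_closed D" and pos: "D \<subseteq> {1..} \<times> {1..}"
    and ne: "\<And>b. b \<in> D \<Longrightarrow> T b \<noteq> {}"
    and diag: "\<And>b x. b \<in> D \<Longrightarrow> x \<in> T b \<Longrightarrow> fst x + snd b = snd x + fst b"
    and row: "\<And>r c x y. (r, c) \<in> D \<Longrightarrow> (r, Suc c) \<in> D \<Longrightarrow> x \<in> T (r, c) \<Longrightarrow> y \<in> T (r, Suc c) \<Longrightarrow> x < y"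
    and col: "\<And>r c x y. (r, c) \<in> D \<Longrightarrow> (Suc r, c) \<in> D \<Longrightarrow> x \<in> T (r, c) \<Longrightarrow> y \<in> T (Suc r, c) \<Longrightarrow> x < y"
  shows "set_tab D T"
proof -
  have "x < y" if "b \<in> D" "b' \<in> D" "fst b \<le> fst b'" "snd b \<le> snd b'" "b \<noteq> b'" "x \<in> T b" "y \<in> T b'"
    for b b' x y
    using that(2-5,7)
  proof (induction "fst b' + snd b'" arbitrary: b' y rule: less_induct)
    case less
    have b1: "1 \<le> fst b" "1 \<le> snd b" using that(1) pos by auto
    have "\<exists>d\<in>D. fst b \<le> fst d \<and> snd b \<le> snd d \<and> fst d + snd d < fst b' + snd b' \<and> (\<forall>z\<in>T d. z < y)"
    proof (cases "snd b < snd b'")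
      case True
      have "(fst b', snd b' - 1) \<in> D"
        by (rule down_closedD[OF dc, of "fst b'" "snd b'"]) (use True b1 less.prems in auto)
      then show ?thesis
        using True less.prems row[of "fst b'" "snd b' - 1" _ y]
        by (intro bexI[of _ "(fst b', snd b' - 1)"]) auto
    next
      case False
      then have lt: "fst b < fst b'" using less.prems by (metis le_neq_implies_less prod_eqI)
      have "(fst b' - 1, snd b') \<in> D"
        by (rule down_closedD[OF dc, of "fst b'" "snd b'"]) (use lt b1 less.prems in auto)
      then show ?thesis
        using lt less.prems col[of "fst b' - 1" "snd b'" _ y]
        by (intro bexI[of _ "(fst b' - 1, snd b')"]) auto
    qed
    then obtain d where d: "d \<in> D" "fst b \<le> fst d" "snd b \<le> snd d" "fst d + snd d < fst b' + snd b'"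
      "\<And>z. z \<in> T d \<Longrightarrow> z < y" by blast
    obtain z where "z \<in> T d" using ne d(1) by blast
    show ?case
    proof (cases "b = d")
      case True
      then show ?thesis using d(5) that(6) by simp
    next
      case False
      then have "x < z" using less.hyps[OF d(4,1,2,3)] \<open>z \<in> T d\<close> by blast
      then show ?thesis using d(5)[OF \<open>z \<in> T d\<close>] by simp
    qed
  qed
  then show ?thesis using ne diag unfolding set_tab_def by blast
qed

text \<open>The entry \<open>t b\<close> lies in some \<open>T e\<close> with \<open>e\<close> on
  the diagonal of \<open>b\<close>. If \<open>e\<close> were above \<open>b\<close>, then by
  induction the entry of the left neighbour of \<open>b\<close> would come from a box weakly below
  and right of \<open>e\<close>, hence exceed \<open>t b\<close>. The right neighbour excludes
  \<open>e\<close> below \<open>b\<close> in the same way.\<close>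

lemma tab_in_set_tab:
  assumes dc: "down_closed D" and fin: "finite D" and pos: "D \<subseteq> {1..} \<times> {1..}"
    and T: "set_tab D T" and t: "tab D t" and sub: "t ` D \<subseteq> (\<Union>b\<in>D. T b)"
    and "b \<in> D"
  shows "t b \<in> T b"
proof -
  have diag: "fst b + snd e = snd b + fst e" if "b \<in> D" "e \<in> D" "t b \<in> T e" for b e
    using tabD(1)[OF t that(1)] set_tabD(2)[OF T that(2,3)] by simp
  have ge: "fst b \<le> fst e" if "b \<in> D" "e \<in> D" "t b \<in> T e" for b e
    using that
  proof (induction "fst b + snd b" arbitrary: b e rule: less_induct)
    case less
    show ?case
    proof (rule ccontr)
      assume lt: "\<not> fst b \<le> fst e"
      define d where "d = (fst b, snd b - 1)"
      have e1: "1 \<le> fst e" "1 \<le> snd e" using less.prems(2) pos by auto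
      note dg = diag[OF less.prems]
      have dD: "d \<in> D"
        unfolding d_def
        by (rule down_closedD[OF dc, of "fst b" "snd b"]) (use lt e1 dg less.prems(1) in simp_all)
      then obtain e' where e': "e' \<in> D" "t d \<in> T e'" using sub by blast
      have "fst d \<le> fst e'" 
        by (rule less.hyps[OF _ dD e']) (use lt e1 dg in \<open>simp add: d_def\<close>)
      then have "t b < t d"
        using diag[OF dD e'] lt dg e1
        by (intro set_tabD(3)[OF T less.prems(2) e'(1) _ _ _ less.prems(3) e'(2)]) (auto simp: d_def)
      moreover have "t d < t b"
        using dD lt e1 dg by (intro tabD(2)[OF t dD less.prems(1)]) (auto simp: d_def prod_eq_iff)
      ultimately show False by simp
    qed
  qed
  \<comment> \<open>\<open>M\<close> turns the induction around: it now runs towards smaller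
    \<open>fst b + snd b\<close>, so that the right neighbour of a box is handled before the
    box.\<close>
  define M where "M = Max ((\<lambda>b. fst b + snd b) ` D)"
  have M: "fst b + snd b \<le> M" if "b \<in> D" for b
    using that fin by (simp add: M_def)
  have le: "fst e \<le> fst b" if "b \<in> D" "e \<in> D" "t b \<in> T e" for b e
    using that
  proof (induction "M - (fst b + snd b)" arbitrary: b e rule: less_induct)
    case less
    show ?case
    proof (rule ccontr)
      assume lt: "\<not> fst e \<le> fst b"
      define d where "d = (fst b, snd b + 1)"
      have b1: "1 \<le> fst b" "1 \<le> snd b" using less.prems(1) pos by auto
      note dg = diag[OF less.prems]
      have dD: "d \<in> D"
        unfolding d_def
      proof (rule down_closedD[OF dc])
        show "(fst e, snd e) \<in> D" using less.prems(2) by simp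
      qed (use lt b1 dg in linarith)+
      then obtain e' where e': "e' \<in> D" "t d \<in> T e'" using sub by blast
      have "fst e' \<le> fst d" 
        by (rule less.hyps[OF _ dD e']) (use M[OF dD] in \<open>simp add: d_def\<close>)
      then have "t d < t b"
        using diag[OF dD e'] lt dg
        by (intro set_tabD(3)[OF T e'(1) less.prems(2) _ _ _ e'(2) less.prems(3)]) (auto simp: d_def)
      moreover have "t b < t d"
        using dD by (intro tabD(2)[OF t less.prems(1) dD]) (auto simp: d_def prod_eq_iff)
      ultimately show False by simp
    qed
  qed
  from \<open>b \<in> D\<close> sub obtain e where e: "e \<in> D" "t b \<in> T e" by blast
  have "e = b"
    using ge[OF \<open>b \<in> D\<close> e] le[OF \<open>b \<in> D\<close> e] diag[OF \<open>b \<in> D\<close> e] by (simp add: prod_eq_iff)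
  then show ?thesis using e by simp
qed

lemma tab_of_set_tab:
  assumes "set_tab D T" "\<And>b. b \<in> D \<Longrightarrow> t b \<in> T b"
  shows "tab D t"
  unfolding tab_def set_tab_def
proof (intro conjI ballI impI)
  fix b b' x y
  assume "b \<in> D" "b' \<in> D" "fst b \<le> fst b'" "snd b \<le> snd b'" "b \<noteq> b'" "x \<in> {t b}" "y \<in> {t b'}"
  then show "x < y" using set_tabD(3)[OF assms(1), of b b' x y] assms(2) by simp
next
  fix b x assume "b \<in> D" "x \<in> {t b}"
  then show "fst x + snd b = snd x + fst b" using set_tabD(2)[OF assms(1), of b x] assms(2) by simp
qed simp

lemma ex_tab_through:
  assumes T: "set_tab D T" and "b \<in> D" "x \<in> T b"
  obtains t where "tab D t" "t b = x" "\<And>d. d \<in> D \<Longrightarrow> t d \<in> T d"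
proof -
  define t where "t d = (if d = b then x else SOME y. y \<in> T d)" for d
  have "t d \<in> T d" if "d \<in> D" for d
    using assms(3) set_tabD(1)[OF T that] unfolding t_def by (auto intro: someI_ex)
  then show thesis using that[of t] tab_of_set_tab[OF T, of t] by (simp add: t_def)
qed

text \<open>Every \<open>x\<close> in \<open>T b\<close> belongs to a single-valued selection from
  \<open>T\<close>. Its crosses all lie in the common union, so \<open>tab_in_set_tab\<close> makes
  it a selection from \<open>T'\<close> as well.\<close>

lemma set_tab_unique:
  assumes D: "down_closed D" "finite D" "D \<subseteq> {1..} \<times> {1..}"
    and T: "set_tab D T" and T': "set_tab D T'"
    and eq: "(\<Union>b\<in>D. T b) = (\<Union>b\<in>D. T' b)" and b: "b \<in> D"
  shows "T b = T' b"
proof -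
  have sub: "S b \<subseteq> S' b"
    if S: "set_tab D S" and S': "set_tab D S'" and eq: "(\<Union>b\<in>D. S b) = (\<Union>b\<in>D. S' b)"
    for S S' :: "nat \<times> nat \<Rightarrow> (nat \<times> nat) set"
  proof
    fix x assume "x \<in> S b"
    from ex_tab_through[OF S b this] obtain t where t: "tab D t" "t b = x" "\<And>d. d \<in> D \<Longrightarrow> t d \<in> S d"
      by blast
    then have "t ` D \<subseteq> (\<Union>b\<in>D. S' b)" using eq by blast
    from tab_in_set_tab[OF D S' t(1) this b] t(2) show "x \<in> S' b" by simp
  qed
  show ?thesis using sub[OF T T' eq] sub[OF T' T eq[symmetric]] by blast
qed

text \<open>Along one diagonal both tableaux increase strictly. The hypothesis puts the entries of
  \<open>t'\<close> there among those of \<open>t\<close>, necessarily on the same diagonal; equal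
  cardinality makes the two sets of entries equal, and increasing functions with equal images
  agree.\<close>

lemma tab_eq_on_diagonal:
  assumes fin: "finite D" and t: "tab D t" and t': "tab D t'"
    and sub: "\<And>b. b \<in> D \<Longrightarrow> snd b + fst a = fst b + snd a \<Longrightarrow> t' b \<in> t ` D"
    and a: "a \<in> D"
  shows "t' a = t a"
proof -
  \<comment> \<open>\<open>g\<close> parametrizes the diagonal of \<open>a\<close> by rows; the
    inequality in \<open>A\<close> keeps the subtraction from being truncated.\<close>
  define g where "g r = (r, r + snd a - fst a)" for r
  define A where "A = {r. g r \<in> D \<and> fst a \<le> r + snd a}"
  have A: "g r \<in> D" "snd (g r) + fst a = fst (g r) + snd a" if "r \<in> A" for r
    using that by (auto simp: A_def g_def)
  have sm: "strict_mono_on A (u \<circ> g)" if "tab D u" for u :: "nat \<times> nat \<Rightarrow> nat \<times> nat"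
  proof (rule strict_mono_onI)
    fix r s assume "r \<in> A" "s \<in> A" "r < s"
    then show "(u \<circ> g) r < (u \<circ> g) s"
      using tabD(2)[OF that, of "g r" "g s"] A by (simp add: g_def)
  qed
  have "finite A"
    using inj_on_finite[of g A D] A(1) fin by (auto simp: inj_on_def g_def)
  have "(t' \<circ> g) ` A \<subseteq> (t \<circ> g) ` A"
  proof
    fix x assume "x \<in> (t' \<circ> g) ` A"
    then obtain r where r: "r \<in> A" "x = t' (g r)" by auto
    then obtain e where e: "e \<in> D" "x = t e" using sub A by blast
    have "fst e + snd (g r) = snd e + fst (g r)"
      using tabD(1)[OF t' A(1)[OF r(1)]] tabD(1)[OF t e(1)] e(2) r(2) by simp
    then have d: "snd e + fst a = fst e + snd a" using A(2)[OF r(1)] by simp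
    then have "g (fst e) = e" by (simp add: g_def prod_eq_iff)
    then have "fst e \<in> A" using e(1) d by (simp add: A_def)
    then show "x \<in> (t \<circ> g) ` A"
      using e(2) \<open>g (fst e) = e\<close> by (intro image_eqI[of _ _ "fst e"]) auto
  qed
  moreover have "card ((u \<circ> g) ` A) = card A" if "tab D u" for u
    by (rule card_image[OF strict_mono_on_imp_inj_on[OF sm[OF that]]])
  ultimately have "(t' \<circ> g) ` A = (t \<circ> g) ` A"
    using \<open>finite A\<close> t t' by (metis card_subset_eq finite_imageI)
  moreover have "fst a \<in> A" using a by (simp add: A_def g_def)
  ultimately have "(t' \<circ> g) (fst a) = (t \<circ> g) (fst a)"
    using strict_mono_on_image_eq_imp_eq[OF sm[OF t'] sm[OF t]] by blast
  then show ?thesis by (simp add: g_def)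
qed

text \<open>\<open>exch\<close> is the combinatorial form of interiority: the codimension-one face
  whose cross set is the image of \<open>t\<close> with \<open>y\<close> added lies in a second
  facet.\<close>

locale exchange =
  fixes D :: "(nat \<times> nat) set" and P :: "(nat \<times> nat) set"
  assumes dc: "down_closed D" and fin: "finite D" and pos: "D \<subseteq> {1..} \<times> {1..}"
    and exch: "\<And>t y. tab D t \<Longrightarrow> t ` D \<subseteq> P \<Longrightarrow> y \<in> P \<Longrightarrow> y \<notin> t ` D \<Longrightarrow>
      \<exists>t'. tab D t' \<and> t' ` D \<noteq> t ` D \<and> t' ` D \<subseteq> insert y (t ` D)"
begin

text \<open>All tableaux have \<open>card D\<close> crosses, so a second one that avoided
  \<open>y\<close> would have the same image as \<open>t\<close>.\<close>

lemma tab_containing: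
  assumes t: "tab D t" "t ` D \<subseteq> P" and y: "y \<in> P"
  obtains t' where "tab D t'" "t' ` D \<subseteq> insert y (t ` D)" "y \<in> t' ` D"
proof (cases "y \<in> t ` D")
  case True
  then show thesis using that[of t] t by blast
next
  case False
  then obtain t' where t': "tab D t'" "t' ` D \<noteq> t ` D" "t' ` D \<subseteq> insert y (t ` D)"
    using exch[OF t y] by blast
  have "y \<in> t' ` D"
  proof (rule ccontr)
    assume "y \<notin> t' ` D"
    then have "t' ` D \<subseteq> t ` D" using t'(3) by blast
    then have "t' ` D = t ` D"
      using fin inj_on_tab[OF t(1)] inj_on_tab[OF t'(1)]
      by (intro card_subset_eq) (simp_all add: card_image)
    then show False using t'(2) by blast
  qed
  then show thesis using that t' by blast
qed

text \<open>If \<open>t2 b' \<le> t1 b\<close>, exchange \<open>y = t2 b'\<close> into the tableau \<open>s\<close> that is as late as possible on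
  the boxes weakly below and right of \<open>b\<close> and equal to \<open>t2\<close> elsewhere. Only the diagonal of \<open>b'\<close>
  changes, so there is no room for \<open>y\<close>: at or after \<open>b'\<close> it would have to exceed \<open>s b\<close>, and before
  \<open>b'\<close> it would have to precede \<open>s d = t2 d\<close> for the other predecessor \<open>d\<close> of \<open>b'\<close>.\<close>

lemma adjacent_less:
  assumes t1: "tab D t1" "t1 ` D \<subseteq> P" and t2: "tab D t2" "t2 ` D \<subseteq> P"
    and b: "b \<in> D" "b' \<in> D" "fst b \<le> fst b'" "snd b \<le> snd b'" "fst b' + snd b' = Suc (fst b + snd b)"
  shows "t1 b < t2 b'"
proof (rule ccontr)
  define y where "y = t2 b'"
  assume "\<not> t1 b < t2 b'"
  then have y: "y \<le> t1 b" by (simp add: y_def)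
  define s where "s d = (if fst b \<le> fst d \<and> snd b \<le> snd d then max (t1 d) (t2 d) else t2 d)" for d
  have sP: "s d = t1 d \<or> s d = t2 d" for d by (auto simp: s_def max_def)
  have s: "tab D s"
    unfolding tab_def set_tab_def
  proof (intro conjI ballI impI)
    fix d d' x z assume d: "d \<in> D" "d' \<in> D" "fst d \<le> fst d'" "snd d \<le> snd d'" "d \<noteq> d'" "x \<in> {s d}" "z \<in> {s d'}"
    have "t1 d < t1 d'" "t2 d < t2 d'" using tabD(2) t1(1) t2(1) d by blast+
    then show "x < z" using d by (auto simp: s_def max_def)
  next
    fix d x assume "d \<in> D" "x \<in> {s d}"
    then show "fst x + snd d = snd x + fst d"
      using tabD(1)[OF t1(1), of d] tabD(1)[OF t2(1), of d] sP[of d] by auto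
  qed auto
  have "s ` D \<subseteq> P" using sP t1(2) t2(2) by (metis image_subset_iff)
  moreover have "y \<in> P" using b(2) t2(2) by (auto simp: y_def)
  ultimately obtain u where u: "tab D u" "u ` D \<subseteq> insert y (s ` D)" "y \<in> u ` D"
    using tab_containing[OF s] by blast
  then obtain e where e: "e \<in> D" "u e = y" by blast
  have dgy: "fst y + snd b' = snd y + fst b'" using tabD(1)[OF t2(1) b(2)] by (simp add: y_def)
  have dge: "fst e + snd b' = snd e + fst b'" using tabD(1)[OF u(1) e(1)] e(2) dgy by simp
  have same: "u d = s d" if d: "d \<in> D" "snd d + fst b' \<noteq> fst d + snd b'" for d
  proof (rule tab_eq_on_diagonal[OF fin s u(1) _ d(1)])
    fix a assume a: "a \<in> D" "snd a + fst d = fst a + snd d"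
    have "u a \<noteq> y" using tabD(1)[OF u(1) a(1)] dgy a(2) d(2) by auto
    then show "u a \<in> s ` D" using u(2) a(1) by blast
  qed
  have adj: "(fst b' = fst b \<and> snd b' = Suc (snd b)) \<or> (fst b' = Suc (fst b) \<and> snd b' = snd b)"
    using b by linarith
  show False
  proof (cases "fst b' \<le> fst e")
    case True
    then have "u b' \<le> y"
      using tabD(2)[OF u(1) b(2) e(1)] dge e(2) by (cases "b' = e") auto
    moreover have "u b < u b'" by (rule tabD(2)[OF u(1) b(1-4)]) (use b(5) in auto)
    moreover have "u b = s b" using adj by (intro same b) auto
    moreover have "t1 b \<le> s b" by (simp add: s_def)
    ultimately show False using y by simp
  next
    case False
    \<comment> \<open>One formula for both cases: \<open>d\<close> is directly above
      \<open>b'\<close> if \<open>b\<close> is to the left of \<open>b'\<close>, and directly to the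
      left if \<open>b\<close> is above. It is outside the region where \<open>s\<close> takes the
      maximum, yet weakly below and right of \<open>e\<close>.\<close>
    define d where "d = (2 * fst b' - 1 - fst b, 2 * snd b' - 1 - snd b)"
    have e1: "1 \<le> fst e" "1 \<le> snd e" using e(1) pos by auto
    have dD: "d \<in> D"
      unfolding d_def
      by (rule down_closedD[OF dc, of "fst b'" "snd b'"]) (use adj e1 False dge b in auto)
    have "u e < u d"
      using adj False dge e1 by (intro tabD(2)[OF u(1) e(1) dD]) (auto simp: d_def)
    moreover have "u d = s d"
      using adj False dge e1 by (intro same dD) (auto simp: d_def)
    moreover have "s d = t2 d"
      using adj False dge e1 by (auto simp: d_def s_def)
    moreover have "t2 d < t2 b'"
      using adj False dge e1 by (intro tabD(2)[OF t2(1) dD b(2)]) (auto simp: d_def prod_eq_iff)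
    ultimately show False using e(2) by (simp add: y_def)
  qed
qed

text \<open>Neighbouring sets are comparable by \<open>adjacent_less\<close>, and every cross of
  \<open>P\<close> occurs because \<open>tab_containing\<close> exchanges it into
  \<open>t0\<close>.\<close>

lemma ex_set_tab:
  assumes t0: "tab D t0" "t0 ` D \<subseteq> P"
  shows "\<exists>T. set_tab D T \<and> (\<Union>b\<in>D. T b) = P"
proof (intro exI conjI)
  let ?T = "\<lambda>b. {t b | t. tab D t \<and> t ` D \<subseteq> P}"
  show "set_tab D ?T"
  proof (rule set_tabI[OF dc pos])
    fix b x assume "b \<in> D" "x \<in> ?T b"
    then show "fst x + snd b = snd x + fst b" using tabD(1) by blast
  next
    fix r c x y assume "(r, c) \<in> D" "(r, Suc c) \<in> D" "x \<in> ?T (r, c)" "y \<in> ?T (r, Suc c)"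
    then show "x < y" using adjacent_less[of _ _ "(r, c)" "(r, Suc c)"] by auto
  next
    fix r c x y assume "(r, c) \<in> D" "(Suc r, c) \<in> D" "x \<in> ?T (r, c)" "y \<in> ?T (Suc r, c)"
    then show "x < y" using adjacent_less[of _ _ "(r, c)" "(Suc r, c)"] by auto
  qed (use t0 in blast)
  show "(\<Union>b\<in>D. ?T b) = P"
  proof
    show "P \<subseteq> (\<Union>b\<in>D. ?T b)"
    proof
      fix x assume "x \<in> P"
      with tab_containing[OF t0] obtain t where t: "tab D t" "t ` D \<subseteq> insert x (t0 ` D)" "x \<in> t ` D"
        by blast
      have "insert x (t0 ` D) \<subseteq> P" using t0(2) \<open>x \<in> P\<close> by simp
      with t(2) have "t ` D \<subseteq> P" by (rule subset_trans)
      moreover obtain b where "b \<in> D" "x = t b" using t(3) by (rule imageE)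
      ultimately show "x \<in> (\<Union>b\<in>D. ?T b)" using t(1) by auto
    qed
  qed blast
qed

end

lemma ex_set_tab_iff:
  assumes D: "down_closed D" "finite D" "D \<subseteq> {1..} \<times> {1..}"
  shows "(\<exists>T. set_tab D T \<and> (\<Union>b\<in>D. T b) = P) \<longleftrightarrow>
    (\<exists>t. tab D t \<and> t ` D \<subseteq> P) \<and>
    (\<forall>t y. tab D t \<longrightarrow> t ` D \<subseteq> P \<longrightarrow> y \<in> P - t ` D \<longrightarrow>
       (\<exists>t'. tab D t' \<and> t' ` D \<noteq> t ` D \<and> t' ` D \<subseteq> insert y (t ` D)))" (is "?L \<longleftrightarrow> ?R")
proof
  assume ?L
  then obtain T where T: "set_tab D T" "(\<Union>b\<in>D. T b) = P" by blast
  show ?R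
  proof (intro conjI allI impI)
    have "\<forall>b\<in>D. \<exists>x. x \<in> T b" using set_tabD(1)[OF T(1)] by blast
    then obtain t where t: "\<And>b. b \<in> D \<Longrightarrow> t b \<in> T b" by metis
    then show "\<exists>t. tab D t \<and> t ` D \<subseteq> P" using tab_of_set_tab[OF T(1)] T(2) by blast
    fix t y assume t: "tab D t" "t ` D \<subseteq> P" and y: "y \<in> P - t ` D"
    then have tT: "t b \<in> T b" if "b \<in> D" for b
      using tab_in_set_tab[OF D T(1) t(1) _ that] T(2) by blast
    obtain b where b: "b \<in> D" "y \<in> T b" using T(2) y by blast
    have "tab D (t(b := y))" using tT b by (intro tab_of_set_tab[OF T(1)]) auto
    moreover have "y \<in> (t(b := y)) ` D" using b by auto
    moreover have "(t(b := y)) ` D \<subseteq> insert y (t ` D)" by auto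
    ultimately show "\<exists>t'. tab D t' \<and> t' ` D \<noteq> t ` D \<and> t' ` D \<subseteq> insert y (t ` D)"
      using y by blast
  qed
next
  assume R: ?R
  have "exchange D P"
  proof (rule exchange.intro[OF D])
    fix t y assume "tab D t" "t ` D \<subseteq> P" "y \<in> P" "y \<notin> t ` D"
    then show "\<exists>t'. tab D t' \<and> t' ` D \<noteq> t ` D \<and> t' ` D \<subseteq> insert y (t ` D)"
      using R[THEN conjunct2, rule_format, of t y] by simp
  qed
  moreover obtain t where "tab D t" "t ` D \<subseteq> P" using R[THEN conjunct1] by blast
  ultimately show ?L by (rule exchange.ex_set_tab)
qed

section \<open>Interior faces\<close>

text \<open>Here \<open>\<R>\<close> stands for the reduced subwords, all of length
  \<open>l\<close>. Facets are complements of members of \<open>\<R>\<close>, and codimension-one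
  faces are complements of sets \<open>insert y R\<close> with \<open>y\<close> outside
  \<open>R\<close>; such a face lies in one facet exactly if \<open>R\<close> is the only member
  inside \<open>insert y R\<close>.\<close>

lemma interior_faces_iff:
  fixes V :: "'a set"
  assumes V: "finite V" and ne: "\<R> \<noteq> {}" and \<R>: "\<And>R. R \<in> \<R> \<Longrightarrow> R \<subseteq> V \<and> card R = l"
    and \<Delta>: "\<Delta> = {V - P | P. P \<subseteq> V \<and> (\<exists>R\<in>\<R>. R \<subseteq> P)}" and P: "P \<subseteq> V"
  shows "V - P \<in> interior_faces \<Delta> \<longleftrightarrow>
    (\<exists>R\<in>\<R>. R \<subseteq> P) \<and>
    (\<forall>R\<in>\<R>. \<forall>y. R \<subseteq> P \<longrightarrow> y \<in> P - R \<longrightarrow> (\<exists>R'\<in>\<R>. R' \<noteq> R \<and> R' \<subseteq> insert y R))"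
proof -
  have face: "V - X \<in> \<Delta> \<longleftrightarrow> (\<exists>R\<in>\<R>. R \<subseteq> X)" if "X \<subseteq> V" for X
  proof
    assume "V - X \<in> \<Delta>"
    then obtain Y where "V - X = V - Y" "Y \<subseteq> V" "\<exists>R\<in>\<R>. R \<subseteq> Y" unfolding \<Delta> by auto
    moreover from this have "X = Y" using that by blast
    ultimately show "\<exists>R\<in>\<R>. R \<subseteq> X" by simp
  qed (use that \<Delta> in blast)
  have finR: "finite R" if "R \<in> \<R>" for R using \<R>[OF that] V finite_subset by blast
  have sub: "F \<subseteq> V" if "F \<in> \<Delta>" for F using that \<Delta> by blast
  have cl: "l \<le> card X" if "X \<subseteq> V" "V - X \<in> \<Delta>" for X
    using face[OF that(1)] that \<R> V by (metis card_mono finite_subset)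
  \<comment> \<open>Equal cardinality makes \<open>\<R>\<close> an antichain, so no complement of a
    member is contained in a larger face.\<close>
  have facet: "facets \<Delta> = (\<lambda>R. V - R) ` \<R>"
  proof
    show "facets \<Delta> \<subseteq> (\<lambda>R. V - R) ` \<R>"
    proof
      fix F assume F: "F \<in> facets \<Delta>"
      then have "F \<in> \<Delta>" by (simp add: facets_def)
      then obtain X R where X: "F = V - X" "X \<subseteq> V" "R \<in> \<R>" "R \<subseteq> X"
        unfolding \<Delta> by blast
      have "V - R \<in> \<Delta>" using face[of R] X \<R> by blast
      moreover have "F \<subseteq> V - R" using X(1,4) by blast
      ultimately have "V - R = F" using F unfolding facets_def by simp
      then show "F \<in> (\<lambda>R. V - R) ` \<R>" using X(3) by blast
    qed
    show "(\<lambda>R. V - R) ` \<R> \<subseteq> facets \<Delta>"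
    proof safe
      fix R assume R: "R \<in> \<R>"
      have "V - R \<in> \<Delta>" using face[of R] R \<R> by blast
      moreover have "G = V - R" if G: "G \<in> \<Delta>" "V - R \<subseteq> G" for G
      proof -
        obtain X R' where X: "G = V - X" "X \<subseteq> V" "R' \<in> \<R>" "R' \<subseteq> X"
          using G(1) unfolding \<Delta> by blast
        then have "R' \<subseteq> R" using G(2) \<R> by blast
        then have "R' = R"
          using R X(3) \<R> finite_subset[OF _ V] by (intro card_subset_eq) auto
        then have "G \<subseteq> V - R" using X(1,4) by blast
        then show ?thesis using G(2) by blast
      qed
      ultimately show "V - R \<in> facets \<Delta>" unfolding facets_def by blast
    qed
  qed
  have cardle: "card X \<le> card V" if "X \<subseteq> V" for X using that V by (rule card_mono[rotated])
  have cd: "card (V - X) = card V - card X" if "X \<subseteq> V" for X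
    using that V by (meson card_Diff_subset finite_subset)
  have Max: "Max (card ` \<Delta>) = card V - l"
  proof (rule Max_eqI)
    have "\<Delta> \<subseteq> Pow V" using sub by blast
    then show "finite (card ` \<Delta>)" using V by (meson finite_Pow_iff finite_imageI finite_subset)
    obtain R where R: "R \<in> \<R>" using ne by blast
    then have "V - R \<in> \<Delta>" using face[of R] \<R> by blast
    moreover have "card (V - R) = card V - l" using cd \<R>[OF R] by simp
    ultimately show "card V - l \<in> card ` \<Delta>" by (metis imageI)
    fix n assume "n \<in> card ` \<Delta>"
    then obtain X where X: "n = card (V - X)" "X \<subseteq> V" "V - X \<in> \<Delta>" unfolding \<Delta> by blast
    then show "n \<le> card V - l" using cl cd by (simp add: diff_le_mono2)
  qed
  have codim: "V - X \<in> codim_one_faces \<Delta> \<longleftrightarrow> (\<exists>R\<in>\<R>. R \<subseteq> X) \<and> card X = l + 1" if X: "X \<subseteq> V" for X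
    using cl[OF X] cd[OF X] cardle[OF X] unfolding codim_one_faces_def mem_Collect_eq Max face[OF X, symmetric]
    by auto
  have boundary: "V - P \<in> boundary_faces \<Delta> \<longleftrightarrow> (\<exists>R\<in>\<R>. R \<subseteq> P) \<and>
    (\<exists>R\<in>\<R>. \<exists>y. R \<subseteq> P \<and> y \<in> P - R \<and> \<not> (\<exists>R'\<in>\<R>. R' \<noteq> R \<and> R' \<subseteq> insert y R))" (is "?L \<longleftrightarrow> ?R")
  proof
    assume ?L
    then obtain G where G: "V - P \<in> \<Delta>" "G \<in> codim_one_faces \<Delta>" "V - P \<subseteq> G"
      "\<exists>!H. H \<in> facets \<Delta> \<and> G \<subseteq> H" unfolding boundary_faces_def by blast
    define X where "X = V - G"
    have "G \<subseteq> V" using G(2) sub unfolding codim_one_faces_def by blast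
    then have X: "G = V - X" "X \<subseteq> V" by (auto simp: X_def)
    then have "(\<exists>R\<in>\<R>. R \<subseteq> X) \<and> card X = l + 1" using codim G(2) by blast
    then obtain R where R: "R \<in> \<R>" "R \<subseteq> X" "card X = l + 1" by blast
    have "card (X - R) = 1"
      using R \<R> finR by (subst card_Diff_subset) auto
    then obtain y where y: "X - R = {y}" by (auto simp: card_1_singleton_iff)
    have XP: "X \<subseteq> P" using G(3) X by blast
    have uniq: "R' = R" if R': "R' \<in> \<R>" "R' \<subseteq> insert y R" for R'
    proof -
      have "V - R' \<in> facets \<Delta> \<and> G \<subseteq> V - R'" "V - R \<in> facets \<Delta> \<and> G \<subseteq> V - R"
        using facet R R' y X by blast+
      then have "V - R' = V - R" using G(4) by blast
      then show ?thesis using \<R>[OF R(1)] \<R>[OF R'(1)] by blast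
    qed
    have "\<not> (\<exists>R'\<in>\<R>. R' \<noteq> R \<and> R' \<subseteq> insert y R)" using uniq by blast
    moreover have "R \<subseteq> P" using R(2) XP by (rule subset_trans)
    moreover have "y \<in> P - R" using y XP by blast
    moreover have "\<exists>R\<in>\<R>. R \<subseteq> P" using face[OF P] G(1) by simp
    ultimately show ?R using R(1) by (intro conjI) auto
  next
    assume ?R
    then obtain R y where R: "R \<in> \<R>" "R \<subseteq> P" "y \<in> P - R"
      and nex: "\<not> (\<exists>R'\<in>\<R>. R' \<noteq> R \<and> R' \<subseteq> insert y R)" by (elim conjE bexE exE)
    have uniq: "R' = R" if "R' \<in> \<R>" "R' \<subseteq> insert y R" for R' using nex that by blast
    have RV: "insert y R \<subseteq> V" using R(2,3) P by blast
    have "card (insert y R) = l + 1"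
      using R(3) \<R>[OF R(1)] finR[OF R(1)] by simp
    moreover have "\<exists>R'\<in>\<R>. R' \<subseteq> insert y R" using R(1) by blast
    ultimately have G: "V - insert y R \<in> codim_one_faces \<Delta>" using codim[OF RV] by simp
    have "\<exists>!H. H \<in> facets \<Delta> \<and> V - insert y R \<subseteq> H"
    proof (rule ex1I[of _ "V - R"])
      fix H assume H: "H \<in> facets \<Delta> \<and> V - insert y R \<subseteq> H"
      then obtain R' where R': "R' \<in> \<R>" "H = V - R'" using facet by blast
      then have "R' \<subseteq> insert y R" using H \<R>[OF R'(1)] RV by blast
      then show "H = V - R" using uniq[OF R'(1)] R' by simp
    next
      show "V - R \<in> facets \<Delta> \<and> V - insert y R \<subseteq> V - R" using facet R(1) by auto
    qed
    moreover have "V - P \<subseteq> V - insert y R" using R(2,3) by blast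
    moreover have "V - P \<in> \<Delta>" using face[OF P] R(1,2) by auto
    ultimately show ?L using G unfolding boundary_faces_def by (intro CollectI conjI bexI[of _ "V - insert y R"])
  qed
  show ?thesis unfolding interior_faces_def Diff_iff boundary face[OF P] by blast
qed

section \<open>The word of the rectangle\<close>

lemma reading_order_Suc:
  "reading_order (Suc k) N = map (Pair (Suc k)) (rev [1..<N + 1]) @ reading_order k N"
  by (simp add: reading_order_def)

lemma set_reading_order: "set (reading_order k N) = rect k N"
  by (auto simp: reading_order_def rect_def image_iff)

lemma sorted_reading_order: "sorted_wrt (>) (reading_order k N)"
proof (induction k)
  case 0
  show ?case by (simp add: reading_order_def)
next
  case (Suc k)
  have "sorted_wrt (>) (map (Pair (Suc k)) (rev [1..<N + 1]))"
    unfolding sorted_wrt_map sorted_wrt_rev by (rule sorted_wrt_mono_rel[OF _ sorted_wrt_upt]) simp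
  then show ?case
    unfolding reading_order_Suc sorted_wrt_append
    using Suc by (auto simp: set_reading_order rect_def)
qed

lemma distinct_reading_order: "distinct (reading_order k N)"
proof -
  have "distinct xs" if "sorted_wrt (>) xs" for xs :: "(nat \<times> nat) list"
    using that by (induction xs) auto
  then show ?thesis using sorted_reading_order by blast
qed

definition subword :: "nat \<Rightarrow> nat \<Rightarrow> (nat \<times> nat) set \<Rightarrow> nat list" where
  "subword k N R = map (letter k) (filter (\<lambda>x. x \<in> R) (reading_order k N))"

text \<open>The boxes are listed without repetition, so positions and boxes correspond bijectively;
  index sets of subwords become sets of boxes.\<close>

lemma Gamma_eq:
  "Gamma m k N \<pi> = {rect k N - P | P. P \<subseteq> rect k N \<and>
     (\<exists>R\<in>{R. R \<subseteq> rect k N \<and> reduced_expression m \<pi> (subword k N R)}. R \<subseteq> P)}"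
proof -
  let ?xs = "reading_order k N" and ?Q = "rect_word k N"
  let ?I = "{..<length ?xs}"
  define g where "g = (!) ?xs"
  have bij: "bij_betw g ?I (rect k N)"
    using bij_betw_nth[OF distinct_reading_order refl set_reading_order[symmetric]] by (simp add: g_def)
  then have inj: "inj_on g ?I" and im: "g ` ?I = rect k N" by (simp_all add: bij_betw_def)
  have Q: "?Q = map (letter k) ?xs" by (simp add: rect_word_def letter_def)
  have len: "length ?Q = length ?xs" by (simp add: Q)
  have word: "nths ?Q R = subword k N (g ` R)" if "R \<subseteq> ?I" for R
  proof -
    have "set (nths ?xs R) = g ` R" using that by (auto simp: set_nths g_def)
    then have "nths ?xs R = filter (\<lambda>x. x \<in> g ` R) ?xs"
      using filter_in_nths[OF distinct_reading_order, of k N R] by simp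
    then show ?thesis by (simp add: Q nths_map subword_def)
  qed
  show ?thesis
  proof (intro set_eqI iffI)
    fix F assume "F \<in> Gamma m k N \<pi>"
    then obtain P R where P: "F = g ` (?I - P)" "P \<subseteq> ?I" "R \<subseteq> P" "reduced_expression m \<pi> (nths ?Q R)"
      unfolding Gamma_def subword_complex_def len g_def by auto
    have "F = rect k N - g ` P" using P(1,2) inj_on_image_set_diff[OF inj, of ?I P] im by auto
    moreover have "g ` P \<subseteq> rect k N" "g ` R \<subseteq> rect k N" "g ` R \<subseteq> g ` P" using P(2,3) im by auto
    moreover have "reduced_expression m \<pi> (subword k N (g ` R))" using word[of R] P by auto
    ultimately show "F \<in> {rect k N - P | P. P \<subseteq> rect k N \<and>
     (\<exists>R\<in>{R. R \<subseteq> rect k N \<and> reduced_expression m \<pi> (subword k N R)}. R \<subseteq> P)}" by blast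
  next
    fix F assume "F \<in> {rect k N - P | P. P \<subseteq> rect k N \<and>
     (\<exists>R\<in>{R. R \<subseteq> rect k N \<and> reduced_expression m \<pi> (subword k N R)}. R \<subseteq> P)}"
    then obtain P R where P: "F = rect k N - P" "P \<subseteq> rect k N" "R \<subseteq> P" "R \<subseteq> rect k N"
      "reduced_expression m \<pi> (subword k N R)" by blast
    define P' R' where "P' = {i \<in> ?I. g i \<in> P}" and "R' = {i \<in> ?I. g i \<in> R}"
    have I: "P' \<subseteq> ?I" "R' \<subseteq> ?I" "R' \<subseteq> P'" using P(3) by (auto simp: P'_def R'_def)
    have "g ` {i \<in> ?I. g i \<in> X} = X" if "X \<subseteq> rect k N" for X
      using that unfolding im[symmetric] by blast
    from this[OF P(2)] this[OF P(4)] have im': "g ` P' = P" "g ` R' = R"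
      by (simp_all only: P'_def R'_def)
    have "F = g ` (?I - P')" 
      using inj_on_image_set_diff[OF inj Diff_subset I(1)] by (simp only: im im' P(1))
    moreover have "reduced_expression m \<pi> (nths ?Q R')" using P(5) by (simp only: word[OF I(2)] im')
    ultimately show "F \<in> Gamma m k N \<pi>"
      using I unfolding Gamma_def subword_complex_def len g_def by blast
  qed
qed

section \<open>The diagram of a Grassmannian permutation\<close>

lemma strict_mono_on_SucI:
  fixes f :: "nat \<Rightarrow> nat"
  assumes "\<And>i j l. i \<in> A \<Longrightarrow> j \<in> A \<Longrightarrow> i \<le> l \<Longrightarrow> l \<le> j \<Longrightarrow> l \<in> A"
    and "\<And>i. i \<in> A \<Longrightarrow> Suc i \<in> A \<Longrightarrow> f i < f (Suc i)"
  shows "strict_mono_on A f"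
proof (rule strict_mono_onI)
  fix i j assume ij: "i \<in> A" "j \<in> A" "i < j"
  then have "Suc i \<le> j" by simp
  then show "f i < f j" using ij(2)
  proof (induction j rule: dec_induct)
    case base
    then show ?case using assms(2) ij by blast
  next
    case (step n)
    have "n \<in> A" using assms(1)[OF ij(1) step.prems, of n] step.hyps by simp
    then show ?case using step assms(2)[of n] by simp
  qed
qed

lemma grassmannian_strict_mono:
  assumes "grassmannian N \<pi>" "k \<in> descents N \<pi>"
  shows "strict_mono_on {1..k} \<pi>" "strict_mono_on {k<..} \<pi>"
proof -
  have perm: "\<pi> permutes {1..N}" and k: "1 \<le> k" "k < N"
    using assms by (auto simp: grassmannian_def descents_def)
  have D: "descents N \<pi> = {k}"
    using assms by (auto simp: grassmannian_def card_1_singleton_iff)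
  have asc: "\<pi> i < \<pi> (Suc i)" if "1 \<le> i" "i \<noteq> k" for i
  proof (cases "i < N")
    case True
    then have "\<not> \<pi> i > \<pi> (Suc i)" using D that unfolding descents_def by auto
    moreover have "\<pi> i \<noteq> \<pi> (Suc i)" using permutes_inj[OF perm] by (metis injD n_not_Suc_n)
    ultimately show ?thesis by simp
  next
    case False
    \<comment> \<open>From \<open>N\<close> on, \<open>\<pi>\<close> does not exceed
      \<open>i\<close> at \<open>i\<close> and fixes \<open>Suc i\<close>, so the ascent is
      automatic.\<close>
    have "\<pi> i \<le> i"
      using permutes_in_image[OF perm, of i] permutes_not_in[OF perm, of i] False that
      by (cases "i = N") auto
    moreover have "\<pi> (Suc i) = Suc i" using permutes_not_in[OF perm, of "Suc i"] False by simp
    ultimately show ?thesis by simp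
  qed
  show "strict_mono_on {1..k} \<pi>" "strict_mono_on {k<..} \<pi>"
    by (rule strict_mono_on_SucI; use asc in auto)+
qed

lemma permutes_ge:
  fixes \<pi> :: "nat \<Rightarrow> nat"
  assumes "\<pi> permutes {1..N}" "strict_mono_on {1..k} \<pi>" "i \<in> {1..k}"
  shows "i \<le> \<pi> i"
proof -
  have "\<pi> 0 = 0" using permutes_not_in[OF assms(1)] by simp
  then have "\<pi> 1 \<noteq> 0" using permutes_inj[OF assms(1)] by (metis injD zero_neq_one)
  then show ?thesis using strict_mono_on_add_le[OF assms(2), of 1 i] assms(3) by auto
qed

text \<open>A row lists the smaller values that occur later. For \<open>p \<le> k\<close> these are
  the \<open>\<pi> p - 1\<close> positive values below \<open>\<pi> p\<close> without the
  \<open>p - 1\<close> values taken before \<open>p\<close>; for \<open>p > k\<close> a box would be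
  an inversion inside the increasing second block.\<close>

lemma card_diagram_row:
  assumes perm: "\<pi> permutes {1..N}" and mono: "strict_mono_on {1..k} \<pi>" "strict_mono_on {k<..} \<pi>"
    and p: "p \<in> {1..N}"
  shows "card {q. (p, q) \<in> diagram N \<pi>} = (if p \<le> k then \<pi> p - p else 0)"
proof -
  have inv: "inv \<pi> (\<pi> i) = i" for i using permutes_inverses(2)[OF perm] .
  have pi: "\<pi> (inv \<pi> i) = i" for i using permutes_inverses(1)[OF perm] .
  have in1: "\<pi> i \<in> {1..N} \<longleftrightarrow> i \<in> {1..N}" for i by (rule permutes_in_image[OF perm])
  have invin: "inv \<pi> i \<in> {1..N} \<longleftrightarrow> i \<in> {1..N}" for i
    by (rule permutes_in_image[OF permutes_inv[OF perm]])
  show ?thesis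
  proof (cases "p \<le> k")
    case True
    have lt: "\<pi> i < \<pi> p" if "i \<in> {1..<p}" for i
      using strict_mono_onD[OF mono(1), of i p] that True by simp
    have "{q. (p, q) \<in> diagram N \<pi>} = {1..<\<pi> p} - \<pi> ` {1..<p}"
    proof (intro set_eqI iffI)
      fix q assume "q \<in> {q. (p, q) \<in> diagram N \<pi>}"
      then show "q \<in> {1..<\<pi> p} - \<pi> ` {1..<p}" by (auto simp: diagram_def inv)
    next
      fix q assume q: "q \<in> {1..<\<pi> p} - \<pi> ` {1..<p}"
      have "\<pi> p \<in> {1..N}" using in1 p by blast
      then have qN: "q \<in> {1..N}" using q by auto
      then have "inv \<pi> q \<in> {1..N}" using invin by blast
      moreover have "inv \<pi> q \<notin> {1..<p}" using q pi by (metis DiffD2 imageI)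
      moreover have "inv \<pi> q \<noteq> p" using q pi by auto
      ultimately have "p < inv \<pi> q" by auto
      then show "q \<in> {q. (p, q) \<in> diagram N \<pi>}" using q p qN by (auto simp: diagram_def)
    qed
    moreover have "\<pi> ` {1..<p} \<subseteq> {1..<\<pi> p}" using lt in1 p by fastforce
    moreover have "card (\<pi> ` {1..<p}) = p - 1"
      using card_image[OF inj_on_subset[OF permutes_inj[OF perm]], of "{1..<p}"] by simp
    ultimately show ?thesis using True p by (simp add: card_Diff_subset)
  next
    case False
    have "{q. (p, q) \<in> diagram N \<pi>} = {}"
    proof (intro equals0I)
      fix q assume "q \<in> {q. (p, q) \<in> diagram N \<pi>}"
      then have "\<pi> p > q" "p < inv \<pi> q" by (auto simp: diagram_def)
      then show False using strict_mono_onD[OF mono(2), of p "inv \<pi> q"] False pi[of q] by simp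
    qed
    then show ?thesis using False by simp
  qed
qed

text \<open>The zeros of a weakly decreasing list form a final segment, so deleting them moves no
  positive part.\<close>

lemma mem_shape_filter:
  assumes "sorted_wrt (\<ge>) xs"
  shows "(r, c) \<in> shape (filter (\<lambda>x. x > 0) xs) \<longleftrightarrow>
    1 \<le> r \<and> r \<le> length xs \<and> 1 \<le> c \<and> c \<le> xs ! (r - 1)"
  using assms
proof (induction xs arbitrary: r)
  case Nil
  show ?case by (simp add: shape_def)
next
  case (Cons x xs)
  show ?case
  proof (cases "x = 0")
    case True
    then have 0: "\<forall>y\<in>set (x # xs). y = 0" using Cons.prems by auto
    then have "filter (\<lambda>x. x > 0) (x # xs) = []" by (intro filter_False) simp
    moreover have "(x # xs) ! (r - 1) = 0" if "1 \<le> r" "r \<le> length (x # xs)"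
    proof -
      have "(x # xs) ! (r - 1) \<in> set (x # xs)" using that by (intro nth_mem) simp
      then show ?thesis using 0 by blast
    qed
    ultimately show ?thesis by (auto simp: shape_def)
  next
    case False
    have IH: "(r', c) \<in> shape (filter (\<lambda>x. x > 0) xs) \<longleftrightarrow>
      1 \<le> r' \<and> r' \<le> length xs \<and> 1 \<le> c \<and> c \<le> xs ! (r' - 1)" for r'
      using Cons by simp
    show ?thesis
    proof (cases "r \<le> 1")
      case True
      then have "r = 0 \<or> r = 1" by linarith
      then show ?thesis using False by (auto simp: shape_def)
    next
      case r: False
      then obtain r' where r': "r = Suc r'" "1 \<le> r'" by (metis Suc_le_D Suc_le_mono not_less_eq_eq One_nat_def)
      then have "(r, c) \<in> shape (filter (\<lambda>x. x > 0) (x # xs)) \<longleftrightarrow> (r', c) \<in> shape (filter (\<lambda>x. x > 0) xs)"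
        using False by (auto simp: shape_def nth_Cons')
      then show ?thesis using IH r' by (auto simp: nth_Cons')
    qed
  qed
qed

text \<open>Row lengths \<open>\<pi> p - p\<close> grow weakly up to \<open>k\<close> and vanish
  afterwards, so sorting the positive ones changes nothing and reversal sends \<open>p\<close> to
  row \<open>k + 1 - p\<close>.\<close>

lemma shape_perm_partition:
  assumes perm: "\<pi> permutes {1..N}" and mono: "strict_mono_on {1..k} \<pi>" "strict_mono_on {k<..} \<pi>"
    and k: "k \<le> N"
  shows "shape (perm_partition N \<pi>) = young k \<pi>"
proof -
  let ?pos = "\<lambda>x::nat. x > 0" and ?xs = "map (\<lambda>p. \<pi> p - p) [1..<k + 1]"
  have "map (\<lambda>p. card {q. (p, q) \<in> diagram N \<pi>}) [1..<N + 1] =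
      map (\<lambda>p. if p \<le> k then \<pi> p - p else 0) [1..<N + 1]"
    by (rule map_cong[OF refl], rule card_diagram_row[OF perm mono]) auto
  moreover have upt: "[1..<N + 1] = [1..<k + 1] @ [k + 1..<N + 1]"
    using k upt_add_eq_append[of 1 "k + 1" "N - k"] by simp
  moreover have "map (\<lambda>p. if p \<le> k then \<pi> p - p else 0) ([1..<k + 1] @ [k + 1..<N + 1]) =
      ?xs @ map (\<lambda>p. 0) [k + 1..<N + 1]" by auto
  moreover have "filter ?pos (map (\<lambda>p. 0) [k + 1..<N + 1]) = []" by (simp add: filter_empty_conv)
  ultimately have "filter ?pos (map (\<lambda>p. card {q. (p, q) \<in> diagram N \<pi>}) [1..<N + 1]) = filter ?pos ?xs"
    by (simp only: filter_append append_Nil2)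
  moreover have "\<pi> i - i \<le> \<pi> j - j" if "1 \<le> i" "i \<le> j" "j \<le> k" for i j
    using strict_mono_on_add_le[OF mono(1) that] that by linarith
  then have sorted: "sorted ?xs"
    unfolding sorted_wrt_map by (intro sorted_wrt_mono_rel[OF _ sorted_upt]) auto
  ultimately have "perm_partition N \<pi> = filter ?pos (rev ?xs)"
    unfolding perm_partition_def by (simp only: sorted_sort_id[OF sorted_wrt_filter[OF sorted]] rev_filter)
  moreover have "sorted_wrt (\<ge>) (rev ?xs)" using sorted by (simp add: sorted_wrt_rev)
  moreover have "length (rev ?xs) = k" by simp
  ultimately have "(r, c) \<in> shape (perm_partition N \<pi>) \<longleftrightarrow>
      1 \<le> r \<and> r \<le> k \<and> 1 \<le> c \<and> c \<le> rev ?xs ! (r - 1)" for r c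
    by (simp only: mem_shape_filter)
  moreover have "rev ?xs ! (r - 1) = \<pi> (k + 1 - r) - (k + 1 - r)" if "1 \<le> r" "r \<le> k" for r
    using that by (simp add: rev_nth Suc_diff_le del: upt_Suc)
  ultimately show ?thesis by (auto simp: young_def)
qed

section \<open>Reduced subwords as tableaux\<close>

lemma young_subset_rect:
  assumes "\<pi> permutes {1..N}"
  shows "young k \<pi> \<subseteq> rect k N"
proof
  fix b assume b: "b \<in> young k \<pi>"
  obtain r c where [simp]: "b = (r, c)" by force
  have "c + (k + 1 - r) \<le> \<pi> (k + 1 - r)" and rc: "1 \<le> r" "r \<le> k" "1 \<le> c"
    using b by (auto simp: young_def)
  moreover have "\<pi> i \<le> max i N" for i
    using permutes_in_image[OF assms, of i] permutes_not_in[OF assms, of i] by (cases "i \<in> {1..N}") auto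
  ultimately have "c + (k + 1 - r) \<le> max (k + 1 - r) N" using order_trans by blast
  then show "b \<in> rect k N" using rc by (auto simp: rect_def max_def split: if_splits)
qed

lemma eq_on_of_young_eq:
  assumes "young k \<rho> = young k \<pi>" "i \<in> {1..k}" "i \<le> \<rho> i" "i \<le> \<pi> i"
  shows "\<rho> i = \<pi> i"
proof -
  have mem: "(k + 1 - i, c) \<in> young k \<sigma> \<longleftrightarrow> 1 \<le> c \<and> c + i \<le> \<sigma> i" for c \<sigma>
    using assms(2) by (auto simp: young_def)
  have "(1 \<le> c \<and> c + i \<le> \<rho> i) \<longleftrightarrow> (1 \<le> c \<and> c + i \<le> \<pi> i)" for c
    using mem[of c \<rho>] mem[of c \<pi>] assms(1) by simp
  from this[of "\<rho> i - i"] this[of "\<pi> i - i"] show ?thesis using assms(3,4) by linarith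
qed

text \<open>The word \<open>w\<^sub>0\<close> attains the lower bound of
  \<open>sum_word_prod\<close>; hence the shortest words for \<open>\<pi>\<close> are those
  attaining it, which are the upward ones.\<close>

lemma reduced_expression_iff_upwalk:
  assumes "upwalk k w\<^sub>0" "set w\<^sub>0 \<subseteq> {1..<m}" "word_prod w\<^sub>0 = \<pi>"
  shows "reduced_expression m \<pi> w \<longleftrightarrow> set w \<subseteq> {1..<m} \<and> word_prod w = \<pi> \<and> upwalk k w"
proof -
  have ge: "(\<Sum>i=1..k. \<pi> i) \<le> \<Sum>{1..k} + length v" if "word_prod v = \<pi>" for v
    using sum_word_prod[of v k] that by simp
  have eq: "(\<Sum>i=1..k. \<pi> i) = \<Sum>{1..k} + length v \<longleftrightarrow> upwalk k v" if "word_prod v = \<pi>" for v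
    using sum_word_prod[of v k] that by simp
  have len: "(\<Sum>i=1..k. \<pi> i) = \<Sum>{1..k} + length w\<^sub>0" using eq assms by blast
  show ?thesis
  proof
    assume red: "reduced_expression m \<pi> w"
    then have w: "set w \<subseteq> {1..<m}" "word_prod w = \<pi>" by (simp_all add: reduced_expression_def)
    have "length w \<le> length w\<^sub>0" using red assms(2,3) by (simp add: reduced_expression_def)
    then have "upwalk k w" using eq[OF w(2)] ge[OF w(2)] len by simp
    with w show "set w \<subseteq> {1..<m} \<and> word_prod w = \<pi> \<and> upwalk k w" by simp
  next
    assume w: "set w \<subseteq> {1..<m} \<and> word_prod w = \<pi> \<and> upwalk k w"
    then have "length w \<le> length v" if "word_prod v = \<pi>" for v
      using eq[of w] ge[OF that] by simp
    with w show "reduced_expression m \<pi> w" by (simp add: reduced_expression_def)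
  qed
qed

lemma reduced_subword_iff:
  assumes perm: "\<pi> permutes {1..N}" and mono: "strict_mono_on {1..k} \<pi>" "strict_mono_on {k<..} \<pi>"
    and m: "k + N \<le> m" and R: "R \<subseteq> rect k N"
  shows "reduced_expression m \<pi> (subword k N R) \<longleftrightarrow> (\<exists>t. tab (young k \<pi>) t \<and> t ` young k \<pi> = R)"
proof -
  let ?D = "young k \<pi>"
  define xs where "xs X = filter (\<lambda>x. x \<in> X) (reading_order k N)" for X
  have sorted: "sorted_wrt (>) (xs X)" for X
    unfolding xs_def by (rule sorted_wrt_filter[OF sorted_reading_order])
  have set_xs: "set (xs X) = X" if "X \<subseteq> rect k N" for X
    using that by (auto simp: xs_def set_reading_order)
  have box: "set (xs X) \<subseteq> {(p, q). p \<le> k \<and> 1 \<le> q}" for X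
    by (auto simp: xs_def set_reading_order rect_def)
  have sw: "subword k N X = map (letter k) (xs X)" for X by (simp add: subword_def xs_def)
  \<comment> \<open>The letters \<open>k - p + q\<close> lie between 1 and \<open>k + N - 1\<close>,
    which is below \<open>m\<close>.\<close>
  have letters: "set (subword k N X) \<subseteq> {1..<m}" for X
    using m by (auto simp: sw xs_def set_reading_order rect_def letter_def)
  have D: "?D \<subseteq> rect k N" by (rule young_subset_rect[OF perm])
  have dc: "down_closed ?D" by (rule down_closed_young[OF mono(1)])
  have Dk: "?D \<subseteq> {1..k} \<times> {1..}" using D by (auto simp: rect_def)
  \<comment> \<open>The diagram fixes the values on \<open>{1..k}\<close>; monotonicity on both
    blocks then fixes the whole permutation.\<close>
  have prod: "word_prod (subword k N X) = \<pi>"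
    if up: "upwalk k (subword k N X)" and y: "young k (word_prod (subword k N X)) = ?D" for X
  proof (rule permutation_eqI_images[of _ _ k])
    let ?\<rho> = "word_prod (subword k N X)"
    have n0: "0 \<notin> set (subword k N X)" using letters[of X] by auto
    then show "?\<rho> 0 = 0" by (rule word_prod_0)
    show "?\<rho> ` {1..k} = \<pi> ` {1..k}"
      using eq_on_of_young_eq[OF y] word_prod_ge[OF up n0] permutes_ge[OF perm mono(1)]
      by (intro image_cong) auto
  qed (use strict_mono_on_word_prod[OF up] mono permutes_not_in[OF perm, of 0] permutes_bij[OF perm]
        bij_word_prod in auto)
  have up_of_tab: "upwalk k (subword k N X) \<and> word_prod (subword k N X) = \<pi>"
    if t: "tab ?D t" "t ` ?D = X" and X: "X \<subseteq> rect k N" for t X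
    using upwalk_of_tab[OF sorted box dc Dk t(1), of X] set_xs[OF X] t(2) prod[of X]
    by (simp add: sw)
  \<comment> \<open>Placing the crosses at the boxes of \<open>?D\<close> themselves gives one
    tableau, hence the reference word required to recognize reduced words.\<close>
  have "tab ?D (\<lambda>b. b)" by (auto simp: tab_def set_tab_def less_prod_simp)
  from up_of_tab[OF this _ D] have "upwalk k (subword k N ?D)" "word_prod (subword k N ?D) = \<pi>" by auto
  note red = reduced_expression_iff_upwalk[OF this(1) letters this(2)]
  show ?thesis
    unfolding red
  proof
    assume w: "set (subword k N R) \<subseteq> {1..<m} \<and> word_prod (subword k N R) = \<pi> \<and> upwalk k (subword k N R)"
    then show "\<exists>t. tab ?D t \<and> t ` ?D = R"
      using tab_of_upwalk[OF sorted box, of R] set_xs[OF R] by (simp add: sw)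
  next
    assume "\<exists>t. tab ?D t \<and> t ` ?D = R"
    then show "set (subword k N R) \<subseteq> {1..<m} \<and> word_prod (subword k N R) = \<pi> \<and> upwalk k (subword k N R)"
      using up_of_tab[OF _ _ R] letters by blast
  qed
qed

text \<open>The reduced subwords form the family \<open>\<R>\<close> of images of tableaux, all of
  size \<open>card ?D\<close> by injectivity. The exchange condition for \<open>\<R>\<close> is that
  of \<open>ex_set_tab_iff\<close>, written with sets in place of tableaux.\<close>

lemma interior_face_iff_set_tab:
  assumes perm: "\<pi> permutes {1..N}" and mono: "strict_mono_on {1..k} \<pi>" "strict_mono_on {k<..} \<pi>"
    and m: "k + N \<le> m" and P: "P \<subseteq> rect k N"
  shows "rect k N - P \<in> interior_faces (Gamma m k N \<pi>) \<longleftrightarrow>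
    (\<exists>T. set_tab (young k \<pi>) T \<and> (\<Union>b\<in>young k \<pi>. T b) = P)"
proof -
  let ?D = "young k \<pi>"
  define \<R> where "\<R> = {R. R \<subseteq> rect k N \<and> (\<exists>t. tab ?D t \<and> t ` ?D = R)}"
  have D: "?D \<subseteq> rect k N" by (rule young_subset_rect[OF perm])
  have fin: "finite (rect k N)" by (simp add: rect_def)
  have D': "down_closed ?D" "finite ?D" "?D \<subseteq> {1..} \<times> {1..}"
    using down_closed_young[OF mono(1)] finite_subset[OF D fin] D by (auto simp: rect_def)
  have mem: "t ` ?D \<in> \<R>" if "tab ?D t" "t ` ?D \<subseteq> rect k N" for t using that by (auto simp: \<R>_def)
  have "tab ?D (\<lambda>b. b)" by (auto simp: tab_def set_tab_def less_prod_simp)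
  then have ne: "\<R> \<noteq> {}" using mem[of "\<lambda>b. b"] D by auto
  have card: "R \<subseteq> rect k N \<and> card R = card ?D" if "R \<in> \<R>" for R
    using that card_image[OF inj_on_tab] by (auto simp: \<R>_def)
  have "{R. R \<subseteq> rect k N \<and> reduced_expression m \<pi> (subword k N R)} = \<R>"
    using reduced_subword_iff[OF perm mono m] by (auto simp: \<R>_def)
  then have G: "Gamma m k N \<pi> = {rect k N - P | P. P \<subseteq> rect k N \<and> (\<exists>R\<in>\<R>. R \<subseteq> P)}"
    by (simp only: Gamma_eq)
  have ex: "(\<exists>R\<in>\<R>. R \<subseteq> P) \<longleftrightarrow> (\<exists>t. tab ?D t \<and> t ` ?D \<subseteq> P)"
    using P by (auto simp: \<R>_def)
  have exch: "(\<exists>R'\<in>\<R>. R' \<noteq> t ` ?D \<and> R' \<subseteq> insert y (t ` ?D)) \<longleftrightarrow>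
      (\<exists>t'. tab ?D t' \<and> t' ` ?D \<noteq> t ` ?D \<and> t' ` ?D \<subseteq> insert y (t ` ?D))"
    if "t ` ?D \<subseteq> P" "y \<in> P" for t y
  proof -
    have "insert y (t ` ?D) \<subseteq> rect k N" using that P by blast
    then have sub: "X \<subseteq> rect k N" if "X \<subseteq> insert y (t ` ?D)" for X using that by (rule subset_trans[rotated])
    show ?thesis
    proof
      assume "\<exists>R'\<in>\<R>. R' \<noteq> t ` ?D \<and> R' \<subseteq> insert y (t ` ?D)"
      then obtain R' where R': "R' \<in> \<R>" "R' \<noteq> t ` ?D" "R' \<subseteq> insert y (t ` ?D)" by (elim bexE conjE)
      then obtain t' where "tab ?D t'" "t' ` ?D = R'" by (auto simp: \<R>_def)
      with R' show "\<exists>t'. tab ?D t' \<and> t' ` ?D \<noteq> t ` ?D \<and> t' ` ?D \<subseteq> insert y (t ` ?D)"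
        by (intro exI[of _ t']) simp
    next
      assume "\<exists>t'. tab ?D t' \<and> t' ` ?D \<noteq> t ` ?D \<and> t' ` ?D \<subseteq> insert y (t ` ?D)"
      then obtain t' where t': "tab ?D t'" "t' ` ?D \<noteq> t ` ?D" "t' ` ?D \<subseteq> insert y (t ` ?D)" by (elim exE conjE)
      then show "\<exists>R'\<in>\<R>. R' \<noteq> t ` ?D \<and> R' \<subseteq> insert y (t ` ?D)"
        by (intro bexI[OF _ mem[OF t'(1) sub[OF t'(3)]]]) simp
    qed
  qed
  have all: "(\<forall>R\<in>\<R>. \<forall>y. R \<subseteq> P \<longrightarrow> y \<in> P - R \<longrightarrow> (\<exists>R'\<in>\<R>. R' \<noteq> R \<and> R' \<subseteq> insert y R)) \<longleftrightarrow>
      (\<forall>t y. tab ?D t \<longrightarrow> t ` ?D \<subseteq> P \<longrightarrow> y \<in> P - t ` ?D \<longrightarrow>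
        (\<exists>t'. tab ?D t' \<and> t' ` ?D \<noteq> t ` ?D \<and> t' ` ?D \<subseteq> insert y (t ` ?D)))" (is "?A \<longleftrightarrow> ?B")
  proof
    assume A: ?A
    show ?B
    proof (intro allI impI)
      fix t y assume t: "tab ?D t" "t ` ?D \<subseteq> P" "y \<in> P - t ` ?D"
      have "t ` ?D \<in> \<R>" by (rule mem[OF t(1) subset_trans[OF t(2) P]])
      then have "\<exists>R'\<in>\<R>. R' \<noteq> t ` ?D \<and> R' \<subseteq> insert y (t ` ?D)"
        using A[rule_format, of "t ` ?D" y] t by simp
      then show "\<exists>t'. tab ?D t' \<and> t' ` ?D \<noteq> t ` ?D \<and> t' ` ?D \<subseteq> insert y (t ` ?D)"
        using exch[of t y] t by simp
    qed
  next
    assume B: ?B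
    show ?A
    proof (intro ballI allI impI)
      fix R y assume R: "R \<in> \<R>" "R \<subseteq> P" "y \<in> P - R"
      then obtain t where t: "tab ?D t" "R = t ` ?D" by (auto simp: \<R>_def)
      then show "\<exists>R'\<in>\<R>. R' \<noteq> R \<and> R' \<subseteq> insert y R"
        using B[rule_format, of t y] exch[of t y] R by simp
    qed
  qed
  show ?thesis
    using interior_faces_iff[OF fin ne card G P] by (simp only: ex all ex_set_tab_iff[OF D'])
qed

section \<open>The bijection\<close>

text \<open>Keeps the crosses of different boxes apart, whereas \<open>Omega\<close> only remembers
  their union; injectivity amounts to recovering this family.\<close>

definition crosses :: "(nat \<times> nat \<Rightarrow> nat set) \<Rightarrow> nat \<times> nat \<Rightarrow> (nat \<times> nat) set" where
  "crosses \<tau> b = (\<lambda>i. (i, i + snd b - fst b)) ` \<tau> b"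

lemma fst_crosses: "fst ` crosses \<tau> b = \<tau> b"
  by (simp add: crosses_def image_image)

lemma UN_crosses: "(\<Union>b\<in>shape lam. crosses \<tau> b) = Omega lam \<tau>"
proof
  show "(\<Union>b\<in>shape lam. crosses \<tau> b) \<subseteq> Omega lam \<tau>"
  proof
    fix x assume "x \<in> (\<Union>b\<in>shape lam. crosses \<tau> b)"
    then obtain r c i where "(r, c) \<in> shape lam" "i \<in> \<tau> (r, c)" "x = (i, i + c - r)"
      unfolding crosses_def by auto
    then show "x \<in> Omega lam \<tau>" unfolding Omega_def by blast
  qed
  show "Omega lam \<tau> \<subseteq> (\<Union>b\<in>shape lam. crosses \<tau> b)"
  proof
    fix x assume "x \<in> Omega lam \<tau>"
    then obtain r c i where b: "(r, c) \<in> shape lam" and "i \<in> \<tau> (r, c)" "x = (i, i + c - r)"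
      unfolding Omega_def by blast
    then have "x \<in> crosses \<tau> (r, c)" by (simp add: crosses_def)
    with b show "x \<in> (\<Union>b\<in>shape lam. crosses \<tau> b)" by (rule UN_I)
  qed
qed

lemma SVT_D:
  assumes "\<tau> \<in> SVT k lam"
  shows "\<tau> \<in> extensional (shape lam)"
    and "b \<in> shape lam \<Longrightarrow> \<tau> b \<noteq> {}"
    and "b \<in> shape lam \<Longrightarrow> x \<in> \<tau> b \<Longrightarrow> 0 < x"
    and "b \<in> shape lam \<Longrightarrow> x \<in> \<tau> b \<Longrightarrow> x \<le> k"
    and "(r, c) \<in> shape lam \<Longrightarrow> (r', c) \<in> shape lam \<Longrightarrow> r < r' \<Longrightarrow> x \<in> \<tau> (r, c) \<Longrightarrow> y \<in> \<tau> (r', c) \<Longrightarrow> x < y"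
    and "(r, c) \<in> shape lam \<Longrightarrow> (r, c') \<in> shape lam \<Longrightarrow> c < c' \<Longrightarrow> x \<in> \<tau> (r, c) \<Longrightarrow> y \<in> \<tau> (r, c') \<Longrightarrow> x \<le> y"
proof -
  have svt: "set_valued_tableau lam \<tau>" and le: "\<forall>b\<in>shape lam. \<forall>x\<in>\<tau> b. x \<le> k"
    using assms by (simp_all add: SVT_def)
  note * = svt[unfolded set_valued_tableau_def]
  show "\<tau> \<in> extensional (shape lam)" using *[THEN conjunct1] by (simp add: PiE_iff)
  show "b \<in> shape lam \<Longrightarrow> \<tau> b \<noteq> {}" "b \<in> shape lam \<Longrightarrow> x \<in> \<tau> b \<Longrightarrow> 0 < x"
    using PiE_mem[OF *[THEN conjunct1], of b] by simp_all
  show "b \<in> shape lam \<Longrightarrow> x \<in> \<tau> b \<Longrightarrow> x \<le> k" using le by simp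
  show "(r, c) \<in> shape lam \<Longrightarrow> (r', c) \<in> shape lam \<Longrightarrow> r < r' \<Longrightarrow> x \<in> \<tau> (r, c) \<Longrightarrow> y \<in> \<tau> (r', c) \<Longrightarrow> x < y"
    by (rule *[THEN conjunct2, THEN conjunct1, rule_format])
  show "(r, c) \<in> shape lam \<Longrightarrow> (r, c') \<in> shape lam \<Longrightarrow> c < c' \<Longrightarrow> x \<in> \<tau> (r, c) \<Longrightarrow> y \<in> \<tau> (r, c') \<Longrightarrow> x \<le> y"
    by (rule *[THEN conjunct2, THEN conjunct2, rule_format])
qed

text \<open>Entries are positive and increase strictly down the column of \<open>r\<close> boxes
  ending at \<open>(r, c)\<close>. This keeps \<open>i + c - r\<close> from being truncated.\<close>

lemma SVT_entry_ge_row: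
  assumes dc: "down_closed (shape lam)" and \<tau>: "\<tau> \<in> SVT k lam"
    and "(r, c) \<in> shape lam" "i \<in> \<tau> (r, c)"
  shows "r \<le> i"
  using assms(3,4)
proof (induction r arbitrary: i)
  case (Suc r)
  show ?case
  proof (cases "r = 0")
    case True
    then show ?thesis using SVT_D(3)[OF \<tau> Suc.prems] by simp
  next
    case False
    have rc: "(r, c) \<in> shape lam"
      by (rule down_closedD[OF dc Suc.prems(1)]) (use False Suc.prems(1) in \<open>auto simp: shape_def\<close>)
    then obtain j where j: "j \<in> \<tau> (r, c)" using SVT_D(2)[OF \<tau>] by blast
    have "j < i" by (rule SVT_D(5)[OF \<tau> rc Suc.prems(1) _ j Suc.prems(2)]) simp
    then show ?thesis using Suc.IH[OF rc j] by simp
  qed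
qed simp

text \<open>Equal entries in a row give crosses in one row with increasing columns, so weak increase
  suffices; down a column strict increase of the first coordinates decides.\<close>

lemma set_tab_crosses:
  assumes dc: "down_closed (shape lam)" and \<tau>: "\<tau> \<in> SVT k lam"
  shows "set_tab (shape lam) (crosses \<tau>)"
proof (rule set_tabI[OF dc])
  show "shape lam \<subseteq> {1..} \<times> {1..}" by (auto simp: shape_def)
  fix b assume "b \<in> shape lam"
  then show "crosses \<tau> b \<noteq> {}" using SVT_D(2)[OF \<tau>] by (simp add: crosses_def)
next
  fix b x assume b: "b \<in> shape lam" "x \<in> crosses \<tau> b"
  then obtain i where i: "i \<in> \<tau> b" "x = (i, i + snd b - fst b)" by (auto simp: crosses_def)
  have "fst b \<le> i" using SVT_entry_ge_row[OF dc \<tau>, of "fst b" "snd b" i] b(1) i(1) by simp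
  then show "fst x + snd b = snd x + fst b" by (simp add: i(2))
next
  fix r c x y
  assume b: "(r, c) \<in> shape lam" "(r, Suc c) \<in> shape lam" "x \<in> crosses \<tau> (r, c)" "y \<in> crosses \<tau> (r, Suc c)"
  then obtain i j where ij: "x = (i, i + c - r)" "i \<in> \<tau> (r, c)" "y = (j, j + Suc c - r)" "j \<in> \<tau> (r, Suc c)"
    unfolding crosses_def by auto
  have "i \<le> j" by (rule SVT_D(6)[OF \<tau> b(1,2) _ ij(2,4)]) simp
  moreover have "r \<le> i" by (rule SVT_entry_ge_row[OF dc \<tau> b(1) ij(2)])
  ultimately show "x < y" unfolding ij less_prod_simp by arith
next
  fix r c x y
  assume b: "(r, c) \<in> shape lam" "(Suc r, c) \<in> shape lam" "x \<in> crosses \<tau> (r, c)" "y \<in> crosses \<tau> (Suc r, c)"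
  then obtain i j where ij: "x = (i, i + c - r)" "i \<in> \<tau> (r, c)" "y = (j, j + c - Suc r)" "j \<in> \<tau> (Suc r, c)"
    unfolding crosses_def by auto
  have "i < j" by (rule SVT_D(5)[OF \<tau> b(1,2) _ ij(2,4)]) simp
  then show "x < y" unfolding ij less_prod_simp by simp
qed

lemma crosses_of_set_tab:
  assumes T: "set_tab (shape lam) T" and rect: "(\<Union>b\<in>shape lam. T b) \<subseteq> rect k N"
  defines "\<tau> \<equiv> restrict (\<lambda>b. fst ` T b) (shape lam)"
  shows "\<tau> \<in> SVT k lam" and "\<And>b. b \<in> shape lam \<Longrightarrow> crosses \<tau> b = T b"
proof -
  have pos: "x \<in> rect k N" if "b \<in> shape lam" "x \<in> T b" for b x using rect that by blast
  show "\<tau> \<in> SVT k lam"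
    unfolding SVT_def set_valued_tableau_def mem_Collect_eq
  proof (intro conjI allI impI ballI)
    show "\<tau> \<in> shape lam \<rightarrow>\<^sub>E {A. A \<noteq> {} \<and> (\<forall>x\<in>A. x > 0)}"
      unfolding \<tau>_def using set_tabD(1)[OF T] pos by (fastforce simp: rect_def)
  next
    fix r r' c x y
    assume h: "(r, c) \<in> shape lam" "(r', c) \<in> shape lam" "r < r'" "x \<in> \<tau> (r, c)" "y \<in> \<tau> (r', c)"
    then obtain q q' where q: "(x, q) \<in> T (r, c)" "(y, q') \<in> T (r', c)" by (auto simp: \<tau>_def)
    \<comment> \<open>If \<open>x = y\<close>, the two diagonals would give \<open>q' < q\<close>,
      against the lexicographic order.\<close>
    have "(x, q) < (y, q')" using set_tabD(3)[OF T h(1,2) _ _ _ q] h(3) by simp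
    moreover have "x + c = q + r" "y + c = q' + r'"
      using set_tabD(2)[OF T h(1) q(1)] set_tabD(2)[OF T h(2) q(2)] by auto
    ultimately show "x < y" using h(3) by auto
  next
    fix r c c' x y
    assume h: "(r, c) \<in> shape lam" "(r, c') \<in> shape lam" "c < c'" "x \<in> \<tau> (r, c)" "y \<in> \<tau> (r, c')"
    then obtain q q' where q: "(x, q) \<in> T (r, c)" "(y, q') \<in> T (r, c')" by (auto simp: \<tau>_def)
    have "(x, q) < (y, q')" using set_tabD(3)[OF T h(1,2) _ _ _ q] h(3) by simp
    then show "x \<le> y" by auto
  next
    fix b x assume h: "b \<in> shape lam" "x \<in> \<tau> b"
    then obtain q where "(x, q) \<in> T b" by (auto simp: \<tau>_def)
    then show "x \<le> k" using pos[OF h(1)] by (auto simp: rect_def)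
  qed
  fix b assume b: "b \<in> shape lam"
  have "(fst x, fst x + snd b - fst b) = x" if "x \<in> T b" for x
    using set_tabD(2)[OF T b that] by (simp add: prod_eq_iff)
  then show "crosses \<tau> b = T b"
    using b by (simp add: crosses_def \<tau>_def image_image)
qed

theorem theorem5p5:
  fixes N k m :: nat and \<pi> :: "nat \<Rightarrow> nat"
  assumes "grassmannian N \<pi>"
    and "k \<in> descents N \<pi>"
    and "k + N \<le> m"
  shows "bij_betw (Omega (perm_partition N \<pi>)) (SVT k (perm_partition N \<pi>))
           {P \<in> pipe_dreams k N. rect k N - P \<in> interior_faces (Gamma m k N \<pi>)}"
proof -
  let ?lam = "perm_partition N \<pi>"
  let ?D = "shape ?lam"
  have perm: "\<pi> permutes {1..N}" and kN: "k \<le> N"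
    using assms by (auto simp: grassmannian_def descents_def)
  note mono = grassmannian_strict_mono[OF assms(1,2)]
  have D: "?D = young k \<pi>" by (rule shape_perm_partition[OF perm mono kN])
  have Drect: "?D \<subseteq> rect k N" unfolding D by (rule young_subset_rect[OF perm])
  have dc: "down_closed ?D" unfolding D by (rule down_closed_young[OF mono(1)])
  have D': "down_closed ?D" "finite ?D" "?D \<subseteq> {1..} \<times> {1..}"
    using dc finite_subset[OF Drect] Drect by (auto simp: rect_def)
  have target: "{P \<in> pipe_dreams k N. rect k N - P \<in> interior_faces (Gamma m k N \<pi>)} =
      {P. P \<subseteq> rect k N \<and> (\<exists>T. set_tab ?D T \<and> (\<Union>b\<in>?D. T b) = P)}"
    using interior_face_iff_set_tab[OF perm mono assms(3)] by (auto simp: pipe_dreams_def D)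
  \<comment> \<open>A cross has row \<open>i \<le> k\<close>, hence column at most
    \<open>k + c - r\<close>, which is less than \<open>\<pi> (k + 1 - r) \<le> N\<close>.\<close>
  have sub: "Omega ?lam \<tau> \<subseteq> rect k N" if \<tau>: "\<tau> \<in> SVT k ?lam" for \<tau>
  proof
    fix x assume "x \<in> Omega ?lam \<tau>"
    then obtain i r c where x: "x = (i, i + c - r)" "(r, c) \<in> ?D" "i \<in> \<tau> (r, c)"
      by (auto simp: Omega_def)
    have "r \<le> i" by (rule SVT_entry_ge_row[OF dc \<tau> x(2,3)])
    moreover have "i \<le> k" by (rule SVT_D(4)[OF \<tau> x(2,3)])
    moreover have "1 \<le> r" "r \<le> k" "1 \<le> c" "c + (k + 1 - r) \<le> \<pi> (k + 1 - r)"
      using x(2) unfolding D by (auto simp: young_def)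
    moreover have "\<pi> (k + 1 - r) \<le> N"
      using permutes_in_image[OF perm, of "k + 1 - r"] kN calculation by auto
    ultimately show "x \<in> rect k N" by (auto simp: rect_def x(1))
  qed
  show ?thesis
    unfolding target
  proof (intro bij_betw_imageI inj_onI set_eqI iffI)
    fix \<tau> \<tau>' assume \<tau>: "\<tau> \<in> SVT k ?lam" and \<tau>': "\<tau>' \<in> SVT k ?lam"
      and eq: "Omega ?lam \<tau> = Omega ?lam \<tau>'"
    \<comment> \<open>\<open>set_tab_unique\<close> recovers the crosses of each box from the union,
      and their first coordinates recover the entries.\<close>
    have "crosses \<tau> b = crosses \<tau>' b" if "b \<in> ?D" for b
      by (rule set_tab_unique[OF D' set_tab_crosses[OF dc \<tau>] set_tab_crosses[OF dc \<tau>'] _ that])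
        (simp only: UN_crosses eq)
    then have "\<tau> b = \<tau>' b" if "b \<in> ?D" for b using fst_crosses that by metis
    then show "\<tau> = \<tau>'" by (rule extensionalityI[OF SVT_D(1)[OF \<tau>] SVT_D(1)[OF \<tau>']])
  next
    fix P assume "P \<in> Omega ?lam ` SVT k ?lam"
    then obtain \<tau> where \<tau>: "\<tau> \<in> SVT k ?lam" "P = Omega ?lam \<tau>" by blast
    then have "set_tab ?D (crosses \<tau>)" "(\<Union>b\<in>?D. crosses \<tau> b) = P" "P \<subseteq> rect k N"
      using set_tab_crosses[OF dc \<tau>(1)] UN_crosses[where lam = ?lam and \<tau> = \<tau>] sub[OF \<tau>(1)] by (simp_all only:)
    then show "P \<in> {P. P \<subseteq> rect k N \<and> (\<exists>T. set_tab ?D T \<and> (\<Union>b\<in>?D. T b) = P)}"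
      by (intro CollectI conjI exI[of _ "crosses \<tau>"])
  next
    fix P assume "P \<in> {P. P \<subseteq> rect k N \<and> (\<exists>T. set_tab ?D T \<and> (\<Union>b\<in>?D. T b) = P)}"
    then obtain T where T: "set_tab ?D T" "(\<Union>b\<in>?D. T b) = P" "P \<subseteq> rect k N" by blast
    then have TR: "(\<Union>b\<in>?D. T b) \<subseteq> rect k N" by simp
    let ?\<tau> = "restrict (\<lambda>b. fst ` T b) ?D"
    have "Omega ?lam ?\<tau> = (\<Union>b\<in>?D. T b)"
      unfolding UN_crosses[symmetric] by (rule SUP_cong[OF refl crosses_of_set_tab(2)[OF T(1) TR]])
    then show "P \<in> Omega ?lam ` SVT k ?lam"
      using crosses_of_set_tab(1)[OF T(1) TR] T(2) by (intro image_eqI[of _ _ ?\<tau>]) simp_all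
  qed
qed

end
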